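(* Let $\alpha\in\mathbb{R}$ and $s>1$. There is a constant $C_s>0$ such that for every $u_0\in H^s_+(\mathbb{S}^1)$, the corresponding unique solution $u$ of $i\partial_tu=\Pi(|u|^2u)+\alpha(u|1)$, $u(0)=u_0$, satisfies $$\|u(t)\|_W\le C_s\|u_0\|_{H^s}\qquad\text{for all } t\in\mathbb{R}.$$
   Context: $\mathbb{S}^1=\{z\in\mathbb{C}:|z|=1\}$, $z=e^{i\theta}$; $(u|v)=\frac1{2\pi}\int_{-\pi}^{\pi}u(e^{ix})\overline{v(e^{ix})}\,dx$; the Szegő projector is $\Pi\big(\sum_{k\in\mathbb{Z}}\hat u(k)e^{ik\theta}\big)=\sum_{k\ge0}\hat u(k)e^{ik\theta}$; $L^2_+$ is the subspace of $L^2(\mathbb{S}^1)$ of functions with $\hat u(k)=0$ for $k<0$; $H^s_+=H^s(\mathbb{S}^1)\cap L^2_+$ with $\|u\|_{H^s}^2=\sum_k(1+k^2)^s|\hat u(k)|^2$. The Wiener norm of $u\in L^2_+$ is $\|u\|_W=\sum_{k=0}^\infty|\hat u(k)|$. The equation is globally well-posed in $H^s_+$ for $s\ge\frac12$ (each datum has a unique global solution, remaining in $H^s_+$). *)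

theory Defs
  imports "HOL-Analysis.Analysis"
begin

text \<open>
  A function on the unit circle is a function \<open>complex \<Rightarrow> complex\<close> of which only the values at the
  points \<open>cis x\<close>, \<open>x \<in> [-\<pi>, \<pi>]\<close>, matter. Elements of \<open>L\<^sup>2\<close> are represented by functions, so equality in
  \<open>L\<^sup>2\<close> is \<open>circle_eq\<close> below.
\<close>

definition circle_eq :: "(complex \<Rightarrow> complex) \<Rightarrow> (complex \<Rightarrow> complex) \<Rightarrow> bool" where
  "circle_eq u v \<longleftrightarrow> (AE x in lebesgue_on {-pi..pi}. u (cis x) = v (cis x))"

definition L2_circle :: "(complex \<Rightarrow> complex) set" where
  "L2_circle = {u. (\<lambda>x. u (cis x)) \<in> borel_measurable (lebesgue_on {-pi..pi}) \<and>
                   integrable (lebesgue_on {-pi..pi}) (\<lambda>x. (cmod (u (cis x)))\<^sup>2)}"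

definition circle_inner :: "(complex \<Rightarrow> complex) \<Rightarrow> (complex \<Rightarrow> complex) \<Rightarrow> complex" where
  "circle_inner u v =
     complex_of_real (1 / (2 * pi)) *
       (\<integral>x. u (cis x) * cnj (v (cis x)) \<partial>(lebesgue_on {-pi..pi}))"

definition fourier_coeff :: "(complex \<Rightarrow> complex) \<Rightarrow> int \<Rightarrow> complex" where
  "fourier_coeff u k = circle_inner u (\<lambda>z. z powi k)"

definition L2_plus :: "(complex \<Rightarrow> complex) set" where
  "L2_plus = {u \<in> L2_circle. \<forall>k<0. fourier_coeff u k = 0}"

text \<open>
  The projector is determined only up to \<open>circle_eq\<close>; \<open>SOME\<close> picks a representative of
  \<open>\<Sum>k\<ge>0. fourier_coeff u k e\<^bsup>ik\<theta>\<^esup>\<close>, which exists for every \<open>u \<in> L\<^sup>2\<close> by the Riesz-Fischer theorem.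
\<close>

definition szego_proj :: "(complex \<Rightarrow> complex) \<Rightarrow> complex \<Rightarrow> complex" where
  "szego_proj u = (SOME v. v \<in> L2_circle \<and>
     (\<forall>k. fourier_coeff v k = (if k \<ge> 0 then fourier_coeff u k else 0)))"

definition Hs_circle :: "real \<Rightarrow> (complex \<Rightarrow> complex) set" where
  "Hs_circle s = {u \<in> L2_circle.
     (\<lambda>k::int. (1 + (real_of_int k)\<^sup>2) powr s * (cmod (fourier_coeff u k))\<^sup>2) summable_on UNIV}"

text \<open>Meaningful on \<open>Hs_circle s\<close> only: elsewhere the sum takes the default value \<open>0\<close>.\<close>

definition Hs_norm :: "real \<Rightarrow> (complex \<Rightarrow> complex) \<Rightarrow> real" where
  "Hs_norm s u =
     sqrt (\<Sum>\<^sub>\<infinity>k::int. (1 + (real_of_int k)\<^sup>2) powr s * (cmod (fourier_coeff u k))\<^sup>2)"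

definition Hs_plus :: "real \<Rightarrow> (complex \<Rightarrow> complex) set" where
  "Hs_plus s = Hs_circle s \<inter> L2_plus"

text \<open>Extended-real valued, so that a finite bound includes the convergence of the series.\<close>

definition wiener_norm :: "(complex \<Rightarrow> complex) \<Rightarrow> ennreal" where
  "wiener_norm u = (\<Sum>k::nat. ennreal (cmod (fourier_coeff u (int k))))"

text \<open>Differentiability at \<open>t\<close>, with derivative \<open>v\<close>, of a curve \<open>u\<close> in \<open>Hs_circle s\<close>.\<close>

definition has_Hs_derivative ::
  "real \<Rightarrow> (real \<Rightarrow> complex \<Rightarrow> complex) \<Rightarrow> (complex \<Rightarrow> complex) \<Rightarrow> real \<Rightarrow> bool" where
  "has_Hs_derivative s u v t \<longleftrightarrow> v \<in> Hs_circle s \<and>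
     ((\<lambda>h. Hs_norm s (\<lambda>z. (u (t + h) z - u t z) / complex_of_real h - v z)) \<longlongrightarrow> 0) (at 0)"

text \<open>
  Global solutions in \<open>Hs_plus s\<close> of \<open>\<i> \<partial>\<^sub>t u = \<Pi>(|u|\<^sup>2 u) + \<alpha> (u|1)\<close>, the time derivative being
  taken in the \<open>H\<^sup>s\<close> norm. For \<open>s > 1/2\<close> the right-hand side is a continuous map of \<open>H\<^sup>s\<^sub>+\<close>, so these are
  exactly the solutions in \<open>C(\<real>, H\<^sup>s\<^sub>+)\<close>, and they are automatically \<open>C\<^sup>1\<close> in time.
\<close>

definition szego_solution :: "real \<Rightarrow> real \<Rightarrow> (real \<Rightarrow> complex \<Rightarrow> complex) \<Rightarrow> bool" where
  "szego_solution \<alpha> s u \<longleftrightarrow>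
     (\<forall>t. u t \<in> Hs_plus s) \<and>
     (\<forall>t. \<exists>v. has_Hs_derivative s u v t \<and>
        circle_eq (\<lambda>z. \<i> * v z)
          (\<lambda>z. szego_proj (\<lambda>w. complex_of_real ((cmod (u t w))\<^sup>2) * u t w) z
                + complex_of_real \<alpha> * circle_inner (u t) (\<lambda>_. 1)))"

end

theory Submission imports Defs begin

text \<open>
  Write \<open>a\<close> for the sequence of Fourier coefficients of \<open>u\<close>, \<open>G\<close> for the Hankel matrix
  \<open>G j k = a (j + k + 1)\<close> and \<open>L\<close> for the lower triangular Toeplitz matrix \<open>L j k = a (j - k)\<close>.
  The projected nonlinearity has the coefficients \<open>c n = \<Sum> a p * a r * cnj (a (p + r - n))\<close>, summed over
  \<open>p + r \<ge> n\<close>. In \<open>c (j + k + 1)\<close> at least one of \<open>p > j\<close> and \<open>r > k\<close> must hold, and the three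
  resulting cases are three matrix products (\<open>cubic_eq_mat_mult\<close>):
  \<open>c (j + k + 1) = (P G + G P\<^sup>T + Q G) j k\<close> with \<open>P = L L\<^sup>*\<close> and \<open>Q = G G\<^sup>*\<close>.
  The perturbation \<open>\<alpha> (u|1)\<close> lives on the coefficient \<open>0\<close>, which does not occur in \<open>G\<close>. So the equation
  turns into the Lax equation \<open>G' = C G + G C\<^sup>T\<close> with the bounded skew-adjoint matrix
  \<open>C = -\<i> (P + Q / 2)\<close> (\<open>lax_pair\<close>).

  Such a flow acts on \<open>G\<close> by unitary matrices on both sides, so it preserves the trace norm of \<open>G\<close>.
  This is proved without constructing the unitary flow. The trace norm is the supremum of
  \<open>\<bar>\<Sum>\<^sub>k (f\<^sub>k, G g\<^sub>k)\<bar>\<close> over finite systems satisfying Bessel's inequality. As \<open>C\<close> is skew,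
  \<open>1 + h C\<close> enlarges norms by a factor \<open>1 + O(h\<^sup>2)\<close> only, and hence the trace norm of \<open>G + h G'\<close> exceeds
  that of \<open>G\<close> by at most \<open>O(h\<^sup>2)\<close> (\<open>trace_norm_lax_step\<close>). The remainder of the difference quotient is
  small in \<open>H\<^sup>s\<close>, and for \<open>s > 1\<close> the \<open>H\<^sup>s\<close> norm dominates the trace norm. The trace norm is
  therefore a continuous function of time that grows at rate at most zero in both time directions,
  so it is constant (\<open>seminorm_conserved\<close>). The same argument shows that the \<open>\<ell>\<^sup>2\<close> norm of \<open>a\<close> is constant.

  The trace norm controls the Wiener norm from above and is controlled by the Sobolev norm:
  testing \<open>G\<close> against coordinate vectors produces the coefficients of odd and of even index, which gives
  \<open>\<Sum> \<bar>a n\<bar> \<le> \<bar>a 0\<bar> + 2 * trace_norm a\<close> (\<open>partial_wiener_le_trace_norm\<close>), while the trace norm is at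
  most the sum of the norms of the rows of \<open>G\<close>, and row \<open>i\<close> is bounded by \<open>(i + 1) powr - s\<close> times the
  \<open>H\<^sup>s\<close> norm (\<open>hankel_row_decay\<close>). The remaining term \<open>a 0\<close> is bounded by the \<open>\<ell>\<^sup>2\<close> norm.

  To pass from functions to sequences, a square-integrable function is identified with the sum of its Fourier
  series whenever that series converges absolutely. This rests on the uniqueness of Fourier
  coefficients (\<open>fourier_coeff_inject\<close>), which also makes the projector computable.
\<close>

(* Two constants share this notation; only the one for unordered sums is meant below. *)
no_notation Infinite_Set_Sum.abs_summable_on (infix \<open>abs'_summable'_on\<close> 50)

section \<open>Fourier coefficients determine a square-integrable function\<close>

abbreviation circle_measure :: "real measure" where
  "circle_measure \<equiv> lebesgue_on {-pi..pi}"

lemma finite_measure_circle_measure: "finite_measure circle_measure"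
  by (intro finite_measure_lebesgue_on) simp

lemma fourier_coeff_eq:
  "fourier_coeff u k = of_real (1 / (2 * pi)) * (\<integral>x. u (cis x) * cis (- (of_int k * x)) \<partial>circle_measure)"
  unfolding fourier_coeff_def circle_inner_def by (simp add: cis_power_int cis_cnj)

lemma cont_cis_circle_measure: "continuous_on UNIV g \<Longrightarrow> (\<lambda>x. g (cis x)) \<in> borel_measurable circle_measure"
  by (rule continuous_imp_measurable_on_sets_lebesgue,
      rule continuous_on_compose2[OF _ continuous_on_cis[OF continuous_on_id]]) auto

lemma cis_measurable [measurable]: "(\<lambda>x. cis (c * x)) \<in> borel_measurable circle_measure"
  by (intro continuous_imp_measurable_on_sets_lebesgue) (auto intro!: continuous_intros)

lemma integrable_mult_bounded:
  fixes f g :: "real \<Rightarrow> complex"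
  assumes f: "integrable circle_measure f" and g: "g \<in> borel_measurable circle_measure"
    and B: "\<And>x. x \<in> {-pi..pi} \<Longrightarrow> cmod (g x) \<le> B"
  shows "integrable circle_measure (\<lambda>x. f x * g x)"
proof (rule Bochner_Integration.integrable_bound)
  show "integrable circle_measure (\<lambda>x. B * norm (f x))" using f by auto
  show "(\<lambda>x. f x * g x) \<in> borel_measurable circle_measure" using f g by measurable
  show "AE x in circle_measure. norm (f x * g x) \<le> norm (B * norm (f x))"
  proof (rule AE_I2)
    fix x assume "x \<in> space circle_measure"
    then have "cmod (g x) \<le> B" using B by auto
    moreover from this have "B \<ge> 0" using norm_ge_zero order_trans by blast
    ultimately show "norm (f x * g x) \<le> norm (B * norm (f x))"
      using mult_left_mono[of "cmod (g x)" B "cmod (f x)"] by (simp add: norm_mult mult.commute)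
  qed
qed

lemma integrable_mult_cis:
  "integrable circle_measure f \<Longrightarrow> integrable circle_measure (\<lambda>x. f x * cis (c * x))"
  by (rule integrable_mult_bounded[where B=1]) auto

lemma L2_circle_integrable:
  assumes "u \<in> L2_circle"
  shows "integrable circle_measure (\<lambda>x. u (cis x))"
proof (rule Bochner_Integration.integrable_bound)
  interpret finite_measure circle_measure by (rule finite_measure_circle_measure)
  show "integrable circle_measure (\<lambda>x. 1 + (cmod (u (cis x)))\<^sup>2)"
    using assms by (intro Bochner_Integration.integrable_add) (auto simp: L2_circle_def)
  show "(\<lambda>x. u (cis x)) \<in> borel_measurable circle_measure" using assms by (simp add: L2_circle_def)
  show "AE x in circle_measure. cmod (u (cis x)) \<le> norm (1 + (cmod (u (cis x)))\<^sup>2)"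
  proof (rule AE_I2)
    fix x
    have "cmod (u (cis x)) \<le> 1 + (cmod (u (cis x)))\<^sup>2"
      using sum_squares_bound[of 1 "cmod (u (cis x))"] norm_ge_zero[of "u (cis x)"]
      by (simp del: norm_ge_zero)
    then show "cmod (u (cis x)) \<le> norm (1 + (cmod (u (cis x)))\<^sup>2)" by simp
  qed
qed

lemma cmod_add_square_le: "(cmod (x + y))\<^sup>2 \<le> 2 * (cmod x)\<^sup>2 + 2 * (cmod y)\<^sup>2"
proof -
  have "(cmod (x + y))\<^sup>2 \<le> (cmod x + cmod y)\<^sup>2"
    by (intro power_mono norm_triangle_ineq norm_ge_zero)
  also have "\<dots> \<le> 2 * (cmod x)\<^sup>2 + 2 * (cmod y)\<^sup>2"
    using sum_squares_bound[of "cmod x" "cmod y"] by (simp add: power2_sum)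
  finally show ?thesis .
qed

lemma L2_circle_lincomb:
  assumes "u \<in> L2_circle" "v \<in> L2_circle"
  shows "(\<lambda>z. a * u z + b * v z) \<in> L2_circle"
proof -
  have m [measurable]: "(\<lambda>x. u (cis x)) \<in> borel_measurable circle_measure" "(\<lambda>x. v (cis x)) \<in> borel_measurable circle_measure"
    using assms by (auto simp: L2_circle_def)
  have "integrable circle_measure (\<lambda>x. (cmod (a * u (cis x) + b * v (cis x)))\<^sup>2)"
  proof (rule Bochner_Integration.integrable_bound)
    show "integrable circle_measure (\<lambda>x. 2 * (cmod a)\<^sup>2 * (cmod (u (cis x)))\<^sup>2 + 2 * (cmod b)\<^sup>2 * (cmod (v (cis x)))\<^sup>2)"
      using assms by (intro Bochner_Integration.integrable_add) (auto simp: L2_circle_def)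
    show "AE x in circle_measure. norm ((cmod (a * u (cis x) + b * v (cis x)))\<^sup>2) \<le>
      norm (2 * (cmod a)\<^sup>2 * (cmod (u (cis x)))\<^sup>2 + 2 * (cmod b)\<^sup>2 * (cmod (v (cis x)))\<^sup>2)"
    proof (rule AE_I2)
      fix x
      have "(cmod (a * u (cis x) + b * v (cis x)))\<^sup>2
          \<le> 2 * (cmod (a * u (cis x)))\<^sup>2 + 2 * (cmod (b * v (cis x)))\<^sup>2"
        by (rule cmod_add_square_le)
      then show "norm ((cmod (a * u (cis x) + b * v (cis x)))\<^sup>2) \<le>
        norm (2 * (cmod a)\<^sup>2 * (cmod (u (cis x)))\<^sup>2 + 2 * (cmod b)\<^sup>2 * (cmod (v (cis x)))\<^sup>2)"
        by (simp add: norm_mult power_mult_distrib)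
    qed
  qed measurable
  then show ?thesis unfolding L2_circle_def by auto
qed

lemma fourier_coeff_lincomb:
  assumes "u \<in> L2_circle" "v \<in> L2_circle"
  shows "fourier_coeff (\<lambda>z. a * u z + b * v z) k = a * fourier_coeff u k + b * fourier_coeff v k"
proof -
  have i: "integrable circle_measure (\<lambda>x. u (cis x) * cis (- of_int k * x))"
          "integrable circle_measure (\<lambda>x. v (cis x) * cis (- of_int k * x))"
    by (intro integrable_mult_cis L2_circle_integrable assms)+
  have "(\<integral>x. (a * u (cis x) + b * v (cis x)) * cis (- of_int k * x) \<partial>circle_measure)
      = a * (\<integral>x. u (cis x) * cis (- of_int k * x) \<partial>circle_measure) + b * (\<integral>x. v (cis x) * cis (- of_int k * x) \<partial>circle_measure)"
    using i by (simp add: distrib_right mult.assoc Bochner_Integration.integral_add)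
  then show ?thesis unfolding fourier_coeff_eq by (simp add: algebra_simps)
qed

lemma fourier_coeff_cong_AE:
  assumes "circle_eq u v"
    "(\<lambda>x. u (cis x)) \<in> borel_measurable circle_measure" "(\<lambda>x. v (cis x)) \<in> borel_measurable circle_measure"
  shows "fourier_coeff u k = fourier_coeff v k"
proof -
  have [measurable]: "(\<lambda>x. cis (- (of_int k * x))) \<in> borel_measurable circle_measure"
    using cis_measurable[of "- of_int k"] by simp
  have "(\<integral>x. u (cis x) * cis (- (of_int k * x)) \<partial>circle_measure) = (\<integral>x. v (cis x) * cis (- (of_int k * x)) \<partial>circle_measure)"
  proof (rule integral_cong_AE)
    show "AE x in circle_measure. u (cis x) * cis (- (of_int k * x)) = v (cis x) * cis (- (of_int k * x))"
      using assms(1) unfolding circle_eq_def by eventually_elim simp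
  qed (use assms in measurable)
  then show ?thesis unfolding fourier_coeff_eq by simp
qed

lemma integral_cis_circle_measure:
  "(\<integral>x. cis (of_int m * x) \<partial>circle_measure) = (if m = 0 then 2 * of_real pi else 0)"
proof -
  have i: "integrable circle_measure (\<lambda>x. cis (of_int m * x))"
    by (intro continuous_imp_integrable_real continuous_intros)
  show ?thesis
  proof (cases "m = 0")
    case True
    have "(\<integral>x. (1::complex) \<partial>circle_measure) = integral {-pi..pi} (\<lambda>x. 1::complex)"
      using i True by (intro lebesgue_integral_eq_integral) auto
    then show ?thesis using True by (simp add: scaleR_conv_of_real)
  next
    case False
    have "((\<lambda>x. cis (of_int m * x)) has_integral
        (cis (of_int m * pi) / (\<i> * of_int m) - cis (of_int m * - pi) / (\<i> * of_int m))) {-pi..pi}"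
    proof (rule fundamental_theorem_of_calculus)
      show "((\<lambda>x. cis (of_int m * x) / (\<i> * of_int m)) has_vector_derivative cis (of_int m * x)) (at x within {-pi..pi})"
        for x
        unfolding has_vector_derivative_def using False
        by (auto intro!: derivative_eq_intros simp: scaleR_conv_of_real fun_eq_iff algebra_simps)
    qed simp
    moreover have "cis (of_int m * pi) = cis (of_int m * - pi)"
      by (simp add: complex_eq_iff)
        (metis sin_int_times_real mult.commute minus_zero sin_integer_2pi sin_npi_int)
    ultimately have "integral {-pi..pi} (\<lambda>x. cis (of_int m * x)) = 0"
      by (simp add: integral_unique)
    then show ?thesis using False lebesgue_integral_eq_integral[OF i] by simp
  qed
qed

lemma fourier_coeff_power:
  "fourier_coeff (\<lambda>z. z powi n) k = (if n = k then 1 else 0)"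
proof -
  have "(\<lambda>x. cis x powi n * cis (- (of_int k * x))) = (\<lambda>x. cis (of_int (n - k) * x))"
    by (auto simp: cis_power_int cis_mult algebra_simps)
  then show ?thesis unfolding fourier_coeff_eq by (simp only: integral_cis_circle_measure) simp
qed


text \<open>
  Orthogonality to all characters, bundled with integrability so that the property is stable under
  multiplication by polynomials in the real coordinates of \<open>cis x\<close>.
\<close>

definition cis_null :: "(real \<Rightarrow> complex) \<Rightarrow> bool" where
  "cis_null f \<longleftrightarrow> integrable circle_measure f \<and> (\<forall>k::int. (\<integral>x. f x * cis (of_int k * x) \<partial>circle_measure) = 0)"

text \<open>
  A linear form in \<open>cis x\<close> is a combination of \<open>cis x\<close> and \<open>cis (- x)\<close>, so multiplying by it only
  shifts the frequency. Leaving \<open>f\<close> arbitrary in the induction makes the product case two applications of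
  the hypothesis.
\<close>

lemma cis_null_mult_polynomial:
  assumes "real_polynomial_function p"
  shows "cis_null f \<Longrightarrow> cis_null (\<lambda>x. f x * of_real (p (cis x)))"
  using assms
proof (induction arbitrary: f)
  case (linear l)
  have lin: "linear l" using linear.hyps by (rule bounded_linear.linear)
  define c where "c = complex_of_real (l 1)"
  define d where "d = complex_of_real (l \<i>)"
  have l: "complex_of_real (l (cis x)) = (c - \<i> * d) / 2 * cis x + (c + \<i> * d) / 2 * cis (- x)" for x
  proof -
    have "cis x = cos x *\<^sub>R 1 + sin x *\<^sub>R \<i>"
      by (simp add: complex_eq_iff)
    then have "l (cis x) = cos x * l 1 + sin x * l \<i>"
      by (simp add: linear_add[OF lin] linear_scale[OF lin])
    then show ?thesis
      unfolding c_def d_def by (simp add: complex_eq_iff field_simps)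
  qed
  have i: "integrable circle_measure (\<lambda>x. f x * cis (of_int k * x))" for k :: int
    using linear.prems by (intro integrable_mult_cis) (simp add: cis_null_def)
  have eq: "f x * of_real (l (cis x)) * cis (of_int k * x) =
      (c - \<i> * d) / 2 * (f x * cis (of_int (k + 1) * x)) + (c + \<i> * d) / 2 * (f x * cis (of_int (k - 1) * x))"
    for k x
  proof -
    have "cis (of_int (k + 1) * x) = cis x * cis (of_int k * x)"
         "cis (of_int (k - 1) * x) = cis (- x) * cis (of_int k * x)"
      by (simp_all add: cis_mult algebra_simps)
    then show ?thesis unfolding l by (simp only:) (simp add: algebra_simps)
  qed
  have "integrable circle_measure (\<lambda>x. f x * of_real (l (cis x)) * cis (of_int k * x))" for k
    unfolding eq by (intro Bochner_Integration.integrable_add integrable_mult_right i)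
  from this[of 0] have "integrable circle_measure (\<lambda>x. f x * of_real (l (cis x)))" by simp
  moreover have "(\<integral>x. f x * of_real (l (cis x)) * cis (of_int k * x) \<partial>circle_measure) = 0" for k
    unfolding eq using linear.prems
    by (subst Bochner_Integration.integral_add) (auto intro!: integrable_mult_right i simp del: of_int_add of_int_diff simp: cis_null_def)
  ultimately show ?case by (simp add: cis_null_def)
next
  case (const c)
  have "(\<integral>x. f x * complex_of_real c * cis (of_int k * x) \<partial>circle_measure) = of_real c * (\<integral>x. f x * cis (of_int k * x) \<partial>circle_measure)" for k :: int
    by (subst integral_mult_right_zero[symmetric]) (simp add: mult_ac)
  then show ?case using const by (simp add: cis_null_def)
next
  case (add p q)
  have "cis_null (\<lambda>x. f x * of_real (p (cis x)))" "cis_null (\<lambda>x. f x * of_real (q (cis x)))"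
    using add by auto
  then show ?case unfolding cis_null_def
    using integrable_mult_cis[of "\<lambda>x. f x * of_real (p (cis x))"] integrable_mult_cis[of "\<lambda>x. f x * of_real (q (cis x))"]
    by (simp add: distrib_left distrib_right)
next
  case (mult p q)
  have "cis_null (\<lambda>x. f x * of_real (p (cis x)) * of_real (q (cis x)))"
    using mult by blast
  then show ?case by (simp add: mult.assoc)
qed

text \<open>
  By the Stone-Weierstrass theorem a continuous function on the circle is a uniform limit of
  polynomials, against which \<open>f\<close> integrates to zero.
\<close>

lemma cis_null_integral_continuous:
  fixes \<phi> :: "complex \<Rightarrow> real"
  assumes f: "cis_null f" and \<phi>: "continuous_on (sphere 0 1) \<phi>"
  shows "(\<integral>x. f x * of_real (\<phi> (cis x)) \<partial>circle_measure) = 0"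
proof -
  have fi: "integrable circle_measure f" using f by (simp add: cis_null_def)
  have meas: "(\<lambda>x. complex_of_real (g (cis x))) \<in> borel_measurable circle_measure"
    if "continuous_on (sphere 0 1) g" for g :: "complex \<Rightarrow> real"
    by (intro continuous_imp_measurable_on_sets_lebesgue continuous_intros continuous_on_compose2[OF that])
       auto
  have small: "cmod (\<integral>x. f x * of_real (\<phi> (cis x)) \<partial>circle_measure) \<le> e * (\<integral>x. cmod (f x) \<partial>circle_measure)" if e: "e > 0" for e
  proof -
    obtain p where p: "real_polynomial_function p" "\<And>z. z \<in> sphere 0 1 \<Longrightarrow> \<bar>\<phi> z - p z\<bar> < e"
      using Stone_Weierstrass_real_polynomial_function[OF compact_sphere \<phi> e] by blast
    have pc: "continuous_on (sphere 0 1) p"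
      using p(1) by (simp add: continuous_on_polymonial_function real_polynomial_function_eq)
    have "cis_null (\<lambda>x. f x * of_real (p (cis x)))"
      by (rule cis_null_mult_polynomial[OF p(1) f])
    then have p0: "integrable circle_measure (\<lambda>x. f x * of_real (p (cis x)))"
        "(\<integral>x. f x * of_real (p (cis x)) \<partial>circle_measure) = 0"
      unfolding cis_null_def by (auto dest: spec[of _ 0])
    have di: "integrable circle_measure (\<lambda>x. f x * of_real (\<phi> (cis x) - p (cis x)))"
      using less_imp_le[OF p(2)]
      by (intro integrable_mult_bounded[where B=e] fi meas continuous_intros \<phi> pc) (auto simp flip: of_real_diff)
    have "(\<integral>x. f x * of_real (\<phi> (cis x)) \<partial>circle_measure)
        = (\<integral>x. f x * of_real (\<phi> (cis x) - p (cis x)) + f x * of_real (p (cis x)) \<partial>circle_measure)"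
      by (simp add: algebra_simps)
    also have "\<dots> = (\<integral>x. f x * of_real (\<phi> (cis x) - p (cis x)) \<partial>circle_measure)"
      using di p0 by (subst Bochner_Integration.integral_add) auto
    finally have "cmod (\<integral>x. f x * of_real (\<phi> (cis x)) \<partial>circle_measure) \<le> (\<integral>x. cmod (f x * of_real (\<phi> (cis x) - p (cis x))) \<partial>circle_measure)"
      by simp
    also have "\<dots> \<le> (\<integral>x. e * cmod (f x) \<partial>circle_measure)"
    proof (rule integral_mono)
      show "integrable circle_measure (\<lambda>x. e * cmod (f x))" using fi by auto
      show "cmod (f x * of_real (\<phi> (cis x) - p (cis x))) \<le> e * cmod (f x)" for x
        using mult_right_mono[OF less_imp_le[OF p(2)[of "cis x"]], of "cmod (f x)"]
        by (simp add: norm_mult mult.commute flip: of_real_diff)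
    qed (use di in auto)
    finally show ?thesis by simp
  qed
  have "(\<integral>x. cmod (f x) \<partial>circle_measure) \<ge> 0" by simp
  then have "cmod (\<integral>x. f x * of_real (\<phi> (cis x)) \<partial>circle_measure) \<le> e" if "e > 0" for e
  proof -
    let ?I = "\<integral>x. cmod (f x) \<partial>circle_measure"
    have pos: "?I + 1 > 0" using \<open>?I \<ge> 0\<close> by linarith
    have "?I / (?I + 1) \<le> 1" by (subst divide_le_eq_1_pos[OF pos]) simp
    then have "e * (?I / (?I + 1)) \<le> e * 1" using that by (intro mult_left_mono) auto
    then have "e / (?I + 1) * ?I \<le> e" by simp
    then show ?thesis using small[OF divide_pos_pos[OF that pos]] by linarith
  qed
  then have "cmod (\<integral>x. f x * of_real (\<phi> (cis x)) \<partial>circle_measure) \<le> 0"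
    by (meson field_le_epsilon add_increasing order_refl le_numeral_extra(3) order.trans)
  then show ?thesis by simp
qed

text \<open>
  The indicator of the arc \<open>cis ` K\<close> is a bounded pointwise limit of continuous functions of the
  distance to it; it agrees with the indicator of \<open>K\<close> except possibly at the end points \<open>-pi\<close> and \<open>pi\<close>,
  which \<open>cis\<close> identifies.
\<close>

lemma cis_null_integral_compact:
  assumes f: "cis_null f" and K: "compact K" "K \<subseteq> {-pi..pi}"
  shows "(\<integral>x. indicator K x *\<^sub>R f x \<partial>circle_measure) = 0"
proof (cases "K = {}")
  case False
  have fi: "integrable circle_measure f" using f by (simp add: cis_null_def)
  have K'c: "closed (cis ` K)"
    by (intro compact_imp_closed compact_continuous_image K continuous_intros)
  \<comment> \<open>Equal to \<open>1\<close> on the arc, and equal to \<open>0\<close> for large \<open>n\<close> at any point off the arc.\<close>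
  define \<phi> where "\<phi> n z = max 0 (1 - real n * infdist z (cis ` K))" for n z
  have cont: "continuous_on S (\<phi> n)" for S n
    unfolding \<phi>_def by (intro continuous_intros)
  have b: "0 \<le> \<phi> n z" "\<phi> n z \<le> 1" for n z
    unfolding \<phi>_def by (auto simp: infdist_nonneg)
  have lim: "(\<lambda>n. \<phi> n z) \<longlonglongrightarrow> indicator (cis ` K) z" for z
  proof (cases "z \<in> cis ` K")
    case True then show ?thesis by (simp add: \<phi>_def)
  next
    case False
    then have pos: "infdist z (cis ` K) > 0"
      using K'c \<open>K \<noteq> {}\<close> by (simp add: in_closed_iff_infdist_zero infdist_nonneg order.strict_iff_order)
    obtain N :: nat where N: "1 < real N * infdist z (cis ` K)" using pos ex_less_of_nat_mult by blast
    have "\<phi> n z = 0" if "n \<ge> N" for n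
    proof -
      have "real N * infdist z (cis ` K) \<le> real n * infdist z (cis ` K)"
        using that pos by (intro mult_right_mono) auto
      then show ?thesis using N by (simp add: \<phi>_def)
    qed
    then show ?thesis using False
      by (intro tendsto_eventually) (auto simp: eventually_sequentially)
  qed
  have m: "(\<lambda>x. complex_of_real (\<phi> n (cis x))) \<in> borel_measurable circle_measure" for n
    by (rule cont_cis_circle_measure[of "\<lambda>z. of_real (\<phi> n z)"]) (intro continuous_intros cont)
  have mK: "(\<lambda>x. complex_of_real (indicator (cis ` K) (cis x))) \<in> borel_measurable circle_measure"
    by (rule borel_measurable_LIMSEQ_metric[where f = "\<lambda>n x. of_real (\<phi> n (cis x))", OF m]) (intro tendsto_intros lim)
  have "(\<lambda>n. \<integral>x. f x * of_real (\<phi> n (cis x)) \<partial>circle_measure) \<longlonglongrightarrow> (\<integral>x. f x * of_real (indicator (cis ` K) (cis x)) \<partial>circle_measure)"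
  proof (rule integral_dominated_convergence[where w = "\<lambda>x. norm (f x)"])
    show "AE x in circle_measure. (\<lambda>n. f x * of_real (\<phi> n (cis x))) \<longlonglongrightarrow> f x * of_real (indicator (cis ` K) (cis x))"
      by (intro AE_I2 tendsto_intros lim)
    show "AE x in circle_measure. norm (f x * of_real (\<phi> n (cis x))) \<le> norm (f x)" for n
      using b[of n] by (intro AE_I2) (simp add: norm_mult mult_left_le)
  qed (use fi m mK in auto)
  moreover have "(\<integral>x. f x * of_real (\<phi> n (cis x)) \<partial>circle_measure) = 0" for n
    by (rule cis_null_integral_continuous[OF f cont])
  ultimately have 0: "(\<integral>x. f x * of_real (indicator (cis ` K) (cis x)) \<partial>circle_measure) = 0"
    by (simp add: LIMSEQ_const_iff)
  have "(\<integral>x. indicator K x *\<^sub>R f x \<partial>circle_measure) = (\<integral>x. f x * of_real (indicator (cis ` K) (cis x)) \<partial>circle_measure)"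
  proof (rule integral_cong_AE)
    have "AE x in circle_measure. x \<noteq> -pi \<and> x \<noteq> pi"
    proof -
      have "{-pi, pi} \<in> null_sets lebesgue"
        by (intro null_sets_completionI countable_imp_null_set_lborel) auto
      then have "{-pi, pi} \<in> null_sets circle_measure"
        by (subst null_sets_restrict_space) auto
      then have "AE x in circle_measure. x \<notin> {-pi, pi}" by (rule AE_not_in)
      then show ?thesis by eventually_elim auto
    qed
    moreover have "AE x in circle_measure. x \<in> {-pi..pi}" by (rule AE_I2) simp
    ultimately show "AE x in circle_measure. indicator K x *\<^sub>R f x = f x * of_real (indicator (cis ` K) (cis x))"
    proof eventually_elim
      case (elim x)
      have "x \<in> K" if "cis x = cis y" "y \<in> K" for y
      proof -
        have Ax: "Arg (cis x) = x" using elim by (intro Arg_cis) auto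
        show ?thesis
        \<comment> \<open>The principal argument of \<open>cis (-pi)\<close> is \<open>pi\<close>.\<close>
        proof (cases "y = -pi")
          case True
          then have "cis x = cis pi" using that by (simp add: complex_eq_iff)
          then have "x = pi" using Ax Arg_cis[of pi] by simp
          then show ?thesis using elim by simp
        next
          case False
          then have "Arg (cis y) = y" using that K by (intro Arg_cis) force
          then show ?thesis using Ax that by simp
        qed
      qed
      then have "cis x \<in> cis ` K \<longleftrightarrow> x \<in> K" by auto
      then show ?case by (simp add: indicator_def)
    qed
    have "K \<in> sets circle_measure" using K by (simp add: sets_restrict_space_iff compact_imp_closed)
    then show "(\<lambda>x. indicat_real K x *\<^sub>R f x) \<in> borel_measurable circle_measure"
      using fi by measurable
    show "(\<lambda>x. f x * of_real (indicator (cis ` K) (cis x))) \<in> borel_measurable circle_measure"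
      using fi mK by measurable
  qed
  then show ?thesis using 0 by simp
qed simp

text \<open>
  Every measurable set is an increasing union of compact sets up to a null set, so the integral of \<open>f\<close>
  over any measurable set vanishes.
\<close>

lemma cis_null_AE_zero:
  assumes f: "cis_null f"
  shows "AE x in circle_measure. f x = 0"
proof -
  interpret finite_measure circle_measure by (rule finite_measure_circle_measure)
  have fi: "integrable circle_measure f" using f by (simp add: cis_null_def)
  show ?thesis
  proof (rule density_zero[OF fi])
    fix A assume A: "A \<in> sets circle_measure"
    then have A': "A \<in> sets lebesgue" "A \<subseteq> {-pi..pi}"
      by (auto simp: sets_restrict_space_iff)
    obtain C T where C: "fsigma C" "T \<in> null_sets lebesgue" "C \<union> T = A"
      using lebesgue_set_almost_fsigma[OF A'(1)] by metis
    obtain F :: "nat \<Rightarrow> real set" where F: "range F \<subseteq> Collect compact" "C = \<Union>(range F)"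
      using C(1) fsigma_Union_compact by blast
    define K where "K n = (\<Union>i\<le>n. F i)" for n
    have K: "compact (K n)" "K n \<subseteq> {-pi..pi}" for n
      unfolding K_def using F C A' by (auto intro!: compact_UN)
    have Km: "K n \<in> sets circle_measure" for n
      using K[of n] by (simp add: sets_restrict_space_iff compact_imp_closed)
    have lim: "(\<lambda>n. indicat_real (K n) x) \<longlonglongrightarrow> indicator C x" for x
    proof (cases "x \<in> C")
      case True
      then obtain i where "x \<in> F i" using F by auto
      then have "indicat_real (K n) x = 1" if "n \<ge> i" for n
        using that by (auto simp: K_def indicator_def)
      then show ?thesis using True
        by (intro tendsto_eventually) (auto simp: eventually_sequentially)
    next
      case False
      then have "x \<notin> K n" for n using F by (auto simp: K_def)
      then show ?thesis using False by simp
    qed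
    have Cm: "C \<in> sets circle_measure"
    proof -
      have "C = (\<Union>n. K n)" using F unfolding K_def by auto
      then show ?thesis using Km by auto
    qed
    have "(\<lambda>n. \<integral>x. indicator (K n) x *\<^sub>R f x \<partial>circle_measure) \<longlonglongrightarrow> (\<integral>x. indicator C x *\<^sub>R f x \<partial>circle_measure)"
    proof (rule integral_dominated_convergence[where w = "\<lambda>x. norm (f x)"])
      show "AE x in circle_measure. (\<lambda>n. indicat_real (K n) x *\<^sub>R f x) \<longlonglongrightarrow> indicator C x *\<^sub>R f x"
        by (intro AE_I2 tendsto_intros lim)
      show "AE x in circle_measure. norm (indicat_real (K n) x *\<^sub>R f x) \<le> norm (f x)" for n
        by (intro AE_I2) (simp add: indicator_def)
    qed (use fi Km Cm in auto)
    then have C0: "(\<integral>x. indicator C x *\<^sub>R f x \<partial>circle_measure) = 0"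
      using cis_null_integral_compact[OF f K] by (simp add: LIMSEQ_const_iff)
    have "T \<in> null_sets circle_measure"
      using C A' by (subst null_sets_restrict_space) auto
    then have "AE x in circle_measure. x \<notin> T" by (rule AE_not_in)
    then have "(\<integral>x. indicator A x *\<^sub>R f x \<partial>circle_measure) = (\<integral>x. indicator C x *\<^sub>R f x \<partial>circle_measure)"
      using C(3) A Cm fi
      by (intro integral_cong_AE) (auto elim!: eventually_mono simp: indicator_def)
    then show "set_lebesgue_integral circle_measure A f = 0"
      using C0 by (simp add: set_lebesgue_integral_def)
  qed
qed

lemma fourier_coeff_inject:
  assumes "u \<in> L2_circle" "v \<in> L2_circle" "\<And>k. fourier_coeff u k = fourier_coeff v k"
  shows "circle_eq u v"
proof -
  let ?w = "\<lambda>z. 1 * u z + (-1) * v z"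
  have w: "?w \<in> L2_circle" using assms(1,2) by (rule L2_circle_lincomb)
  have w0: "fourier_coeff ?w k = 0" for k
    using fourier_coeff_lincomb[OF assms(1,2), of 1 "-1" k] assms(3)[of k] by simp
  have "cis_null (\<lambda>x. ?w (cis x))"
    unfolding cis_null_def
  proof (intro conjI allI L2_circle_integrable[OF w])
    show "(\<integral>x. ?w (cis x) * cis (of_int k * x) \<partial>circle_measure) = 0" for k
      using w0[of "-k"] by (simp add: fourier_coeff_eq)
  qed
  then have "AE x in circle_measure. ?w (cis x) = 0" by (rule cis_null_AE_zero)
  then show ?thesis unfolding circle_eq_def by (auto elim: eventually_mono)
qed

section \<open>Absolutely convergent power series on the circle\<close>

text \<open>
  On \<open>L2_plus\<close> the Fourier series is a power series in \<open>z = cis x\<close>.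
\<close>

definition power_series :: "(nat \<Rightarrow> complex) \<Rightarrow> complex \<Rightarrow> complex" where
  "power_series a z = (\<Sum>n. a n * z ^ n)"

definition circle_bounded :: "(complex \<Rightarrow> complex) \<Rightarrow> bool" where
  "circle_bounded w \<longleftrightarrow> (\<lambda>x. w (cis x)) \<in> borel_measurable circle_measure \<and> (\<exists>B. \<forall>x. cmod (w (cis x)) \<le> B)"

lemma circle_bounded_L2: "circle_bounded w \<Longrightarrow> w \<in> L2_circle"
proof -
  assume w: "circle_bounded w"
  interpret finite_measure circle_measure by (rule finite_measure_circle_measure)
  obtain B where B: "\<And>x. cmod (w (cis x)) \<le> B" using w by (auto simp: circle_bounded_def)
  have [measurable]: "(\<lambda>x. w (cis x)) \<in> borel_measurable circle_measure" using w by (simp add: circle_bounded_def)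
  have "integrable circle_measure (\<lambda>x. (cmod (w (cis x)))\<^sup>2)"
    by (rule integrable_const_bound[where B="B\<^sup>2"]) (auto intro!: AE_I2 power_mono B)
  then show ?thesis by (simp add: L2_circle_def)
qed

lemma circle_bounded_mult:
  assumes "circle_bounded v" "circle_bounded w"
  shows "circle_bounded (\<lambda>z. v z * w z)"
proof -
  obtain B C where B: "\<And>x. cmod (v (cis x)) \<le> B" and C: "\<And>x. cmod (w (cis x)) \<le> C"
    using assms by (auto simp: circle_bounded_def)
  have "cmod (v (cis x) * w (cis x)) \<le> B * C" for x
    unfolding norm_mult by (intro mult_mono B C norm_ge_zero order_trans[OF norm_ge_zero B])
  then show ?thesis using assms by (auto simp: circle_bounded_def)
qed

lemma circle_bounded_cnj: "circle_bounded w \<Longrightarrow> circle_bounded (\<lambda>z. cnj (w z))"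
  unfolding circle_bounded_def
  by (auto intro: borel_measurable_continuous_on[OF continuous_on_cnj[OF continuous_on_id]])

lemma fourier_coeff_cnj: "fourier_coeff (\<lambda>z. cnj (w z)) m = cnj (fourier_coeff w (- m))"
proof -
  have "(\<integral>x. cnj (w (cis x)) * cis (- (of_int m * x)) \<partial>circle_measure) = cnj (\<integral>x. w (cis x) * cis (- (of_int (- m) * x)) \<partial>circle_measure)"
    by (subst integral_bounded_linear'[OF bounded_linear_cnj bounded_linear_cnj, symmetric]) (simp_all add: cis_cnj)
  then show ?thesis unfolding fourier_coeff_eq by simp
qed

context
  fixes a :: "nat \<Rightarrow> complex"
  assumes a: "a abs_summable_on UNIV"
begin

lemma power_series_summable: "cmod z = 1 \<Longrightarrow> summable (\<lambda>n. norm (a n * z ^ n))"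
  using summable_on_imp_summable[OF a] by (simp add: norm_mult norm_power)

lemma power_series_circle_bounded: "circle_bounded (power_series a)"
  unfolding circle_bounded_def
proof
  show "(\<lambda>x. power_series a (cis x)) \<in> borel_measurable circle_measure"
    unfolding power_series_def Complex.DeMoivre by (intro borel_measurable_suminf borel_measurable_times cis_measurable) simp
  have "cmod (power_series a (cis x)) \<le> (\<Sum>n. cmod (a n))" for x
    using summable_norm[OF power_series_summable[of "cis x"]] by (simp add: power_series_def norm_mult norm_power)
  then show "\<exists>B. \<forall>x. cmod (power_series a (cis x)) \<le> B" by blast
qed

text \<open>
  Termwise integration, dominated by \<open>\<Sum> cmod (a k)\<close> times a bound for \<open>w\<close>: multiplication of functions is
  convolution of coefficients.
\<close>

lemma fourier_coeff_power_series_mult: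
  assumes w: "circle_bounded w"
  shows "fourier_coeff (\<lambda>z. power_series a z * w z) n = (\<Sum>\<^sub>\<infinity>k. a k * fourier_coeff w (n - int k))"
proof -
  interpret finite_measure circle_measure by (rule finite_measure_circle_measure)
  obtain B where B: "\<And>x. cmod (w (cis x)) \<le> B" using w by (auto simp: circle_bounded_def)
  have wi: "integrable circle_measure (\<lambda>x. w (cis x))" by (intro L2_circle_integrable circle_bounded_L2 w)
  define I where "I = (\<integral>x. cmod (w (cis x)) \<partial>circle_measure)"
  define f where "f k x = a k * (w (cis x) * cis (- of_int (n - int k) * x))" for k x
  have fi: "integrable circle_measure (f k)" for k
    unfolding f_def by (intro integrable_mult_right integrable_mult_cis wi)
  have fn: "norm (f k x) = cmod (a k) * cmod (w (cis x))" for k x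
    by (simp add: f_def norm_mult)
  have sa: "summable (\<lambda>k. cmod (a k))" using summable_on_imp_summable[OF a] .
  have s2: "summable (\<lambda>k. \<integral>x. norm (f k x) \<partial>circle_measure)"
    unfolding fn using sa by (simp add: summable_mult2)
  have s1: "AE x in circle_measure. summable (\<lambda>k. norm (f k x))"
    unfolding fn using sa by (intro AE_I2 summable_mult2)
  have pt: "power_series a (cis x) * w (cis x) * cis (- (of_int n * x)) = (\<Sum>k. f k x)" for x
  proof -
    have "summable (\<lambda>k. a k * cis x ^ k)"
      by (rule summable_norm_cancel[OF power_series_summable]) simp
    then have "(\<Sum>k. a k * cis x ^ k) * (w (cis x) * cis (- (of_int n * x)))
        = (\<Sum>k. a k * cis x ^ k * (w (cis x) * cis (- (of_int n * x))))"
      by (rule suminf_mult2)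
    also have "\<dots> = (\<Sum>k. f k x)"
      unfolding f_def Complex.DeMoivre
      by (intro suminf_cong) (simp add: cis_mult algebra_simps flip: mult.assoc)
    finally show ?thesis by (simp add: power_series_def mult.assoc)
  qed
  have coe: "of_real (1 / (2 * pi)) * (\<integral>x. f k x \<partial>circle_measure) = a k * fourier_coeff w (n - int k)" for k
  proof -
    have "- of_int (n - int k) * x = - (of_int (n - int k) * x)" for x :: real
      by (simp add: algebra_simps)
    then show ?thesis unfolding f_def fourier_coeff_eq by (simp only: integral_mult_right_zero mult_ac)
  qed
  have sums: "(\<lambda>k. of_real (1 / (2 * pi)) * (\<integral>x. f k x \<partial>circle_measure)) sums fourier_coeff (\<lambda>z. power_series a z * w z) n"
    unfolding fourier_coeff_eq pt by (intro sums_mult sums_integral fi s1 s2)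
  have bd: "cmod (fourier_coeff w m) \<le> 1 / (2 * pi) * I" for m
  proof -
    have "cmod (\<integral>x. w (cis x) * cis (- (of_int m * x)) \<partial>circle_measure) \<le> I"
      unfolding I_def by (rule order_trans[OF integral_norm_bound]) (simp add: norm_mult)
    then show ?thesis unfolding fourier_coeff_eq norm_mult norm_of_real by (intro mult_mono) auto
  qed
  have "(\<lambda>k. a k * fourier_coeff w (n - int k)) abs_summable_on UNIV"
  proof (rule Infinite_Sum.abs_summable_on_comparison_test'[where g="\<lambda>k. cmod (a k) * (1 / (2 * pi) * I)"])
    show "(\<lambda>k. cmod (a k) * (1 / (2 * pi) * I)) summable_on UNIV"
      using a by (rule summable_on_cmult_left)
    show "norm (a k * fourier_coeff w (n - int k)) \<le> cmod (a k) * (1 / (2 * pi) * I)" for k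
      unfolding norm_mult by (intro mult_left_mono bd norm_ge_zero)
  qed
  then have "(\<lambda>k. a k * fourier_coeff w (n - int k)) sums (\<Sum>\<^sub>\<infinity>k. a k * fourier_coeff w (n - int k))"
    by (rule has_sum_imp_sums[OF has_sum_infsum[OF abs_summable_summable]])
  then show ?thesis using sums unfolding coe by (rule sums_unique2[symmetric])
qed

lemma fourier_coeff_power_series:
  "fourier_coeff (power_series a) n = (if n \<ge> 0 then a (nat n) else 0)"
proof -
  have one: "circle_bounded (\<lambda>_. 1)" by (auto simp: circle_bounded_def)
  have f1: "fourier_coeff (\<lambda>_. 1) m = (if m = 0 then 1 else 0)" for m
    using fourier_coeff_power[of 0 m] by simp
  have "fourier_coeff (power_series a) n = (\<Sum>\<^sub>\<infinity>k. a k * (if n - int k = 0 then 1 else 0))"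
    using fourier_coeff_power_series_mult[OF one, of n] by (simp add: f1)
  also have "\<dots> = (\<Sum>\<^sub>\<infinity>k\<in>(if n \<ge> 0 then {nat n} else {}). a k)"
    by (rule infsum_cong_neutral) (auto split: if_splits)
  finally show ?thesis by simp
qed

text \<open>
  \<open>\<bar>u\<bar>\<^sup>2 u = u (u \<cdot> cnj u)\<close>, so two applications of the convolution rule suffice.
\<close>

lemma fourier_coeff_cubic:
  "fourier_coeff (\<lambda>z. of_real ((cmod (power_series a z))\<^sup>2) * power_series a z) (int n) =
    (\<Sum>\<^sub>\<infinity>p. \<Sum>\<^sub>\<infinity>r. a p * a r * (if n \<le> p + r then cnj (a (p + r - n)) else 0))"
proof -
  note b = power_series_circle_bounded
  have eq: "(\<lambda>z. of_real ((cmod (power_series a z))\<^sup>2) * power_series a z) = (\<lambda>z. power_series a z * (power_series a z * cnj (power_series a z)))"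
    by (simp only: complex_norm_square mult_ac)
  have "fourier_coeff (\<lambda>z. of_real ((cmod (power_series a z))\<^sup>2) * power_series a z) (int n) =
     (\<Sum>\<^sub>\<infinity>p. a p * (\<Sum>\<^sub>\<infinity>r. a r * cnj (fourier_coeff (power_series a) (- (int n - int p - int r)))))"
    unfolding eq
    by (simp only: fourier_coeff_power_series_mult circle_bounded_mult circle_bounded_cnj b fourier_coeff_cnj)
  also have "\<dots> = (\<Sum>\<^sub>\<infinity>p. a p * (\<Sum>\<^sub>\<infinity>r. a r * (if n \<le> p + r then cnj (a (p + r - n)) else 0)))"
  proof (intro infsum_cong arg_cong2[where f="(*)"] refl)
    fix p r
    have "nat (- (int n - int p - int r)) = p + r - n" by simp
    then show "cnj (fourier_coeff (power_series a) (- (int n - int p - int r))) = (if n \<le> p + r then cnj (a (p + r - n)) else 0)"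
      unfolding fourier_coeff_power_series by auto
  qed
  finally show ?thesis
    by (simp only: infsum_cmult_right'[symmetric] mult.assoc)
qed

end

section \<open>Square-summable sequences and matrices with summable rows and columns\<close>

definition ell2 :: "(nat \<Rightarrow> complex) \<Rightarrow> bool" where
  "ell2 x \<longleftrightarrow> (\<lambda>n. (cmod (x n))\<^sup>2) summable_on UNIV"

definition l2_norm :: "(nat \<Rightarrow> complex) \<Rightarrow> real" where
  "l2_norm x = sqrt (\<Sum>\<^sub>\<infinity>n. (cmod (x n))\<^sup>2)"

text \<open>
  The bilinear pairing, without complex conjugation: the Lax equation involves \<open>C\<close> and its transpose,
  and the transpose is the adjoint for this pairing.
\<close>

definition dot :: "(nat \<Rightarrow> complex) \<Rightarrow> (nat \<Rightarrow> complex) \<Rightarrow> complex" where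
  "dot x y = (\<Sum>\<^sub>\<infinity>n. x n * y n)"

lemma l2_norm_nonneg [simp]: "0 \<le> l2_norm x"
  unfolding l2_norm_def by (simp add: infsum_nonneg)

lemma l2_norm_power2: "(l2_norm x)\<^sup>2 = (\<Sum>\<^sub>\<infinity>n. (cmod (x n))\<^sup>2)"
  unfolding l2_norm_def by (simp add: infsum_nonneg)

lemma L2_set_le_l2_norm:
  assumes "ell2 x" "finite F"
  shows "L2_set (\<lambda>n. cmod (x n)) F \<le> l2_norm x"
  unfolding L2_set_def l2_norm_def
  using assms by (intro real_sqrt_le_mono finite_sum_le_infsum) (auto simp: ell2_def)

lemma ell2I_finite_sums:
  assumes "\<And>F. finite F \<Longrightarrow> (\<Sum>n\<in>F. (cmod (x n))\<^sup>2) \<le> B\<^sup>2" "B \<ge> 0"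
  shows "ell2 x" "l2_norm x \<le> B"
proof -
  show "ell2 x" unfolding ell2_def
    by (rule nonneg_bdd_above_summable_on) (use assms in \<open>auto intro!: bdd_aboveI2\<close>)
  then have "(\<Sum>\<^sub>\<infinity>n. (cmod (x n))\<^sup>2) \<le> B\<^sup>2"
    by (intro infsum_le_finite_sums) (use assms in \<open>auto simp: ell2_def\<close>)
  then show "l2_norm x \<le> B"
    unfolding l2_norm_def using assms(2) by (simp add: real_le_lsqrt)
qed

lemma cauchy_schwarz_ell2:
  assumes "ell2 x" "ell2 y"
  shows "(\<lambda>n. x n * y n) abs_summable_on UNIV"
    and "(\<Sum>\<^sub>\<infinity>n. cmod (x n * y n)) \<le> l2_norm x * l2_norm y"
    and "cmod (dot x y) \<le> l2_norm x * l2_norm y"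
proof -
  have fin: "(\<Sum>n\<in>F. cmod (x n * y n)) \<le> l2_norm x * l2_norm y" if "finite F" for F
  proof -
    have "(\<Sum>n\<in>F. cmod (x n * y n)) = (\<Sum>n\<in>F. \<bar>cmod (x n)\<bar> * \<bar>cmod (y n)\<bar>)"
      by (simp add: norm_mult)
    also have "\<dots> \<le> L2_set (\<lambda>n. cmod (x n)) F * L2_set (\<lambda>n. cmod (y n)) F"
      by (rule L2_set_mult_ineq)
    also have "\<dots> \<le> l2_norm x * l2_norm y"
      using assms that by (intro mult_mono L2_set_le_l2_norm) auto
    finally show ?thesis .
  qed
  show 1: "(\<lambda>n. x n * y n) abs_summable_on UNIV"
    by (rule nonneg_bdd_above_summable_on) (use fin in \<open>auto intro!: bdd_aboveI2\<close>)
  show 2: "(\<Sum>\<^sub>\<infinity>n. cmod (x n * y n)) \<le> l2_norm x * l2_norm y"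
    using 1 fin by (intro infsum_le_finite_sums) auto
  show "cmod (dot x y) \<le> l2_norm x * l2_norm y"
    unfolding dot_def using norm_infsum_bound[OF 1] 2 by linarith
qed

lemma ell2_add:
  assumes "ell2 x" "ell2 y"
  shows "ell2 (\<lambda>n. x n + y n)" "l2_norm (\<lambda>n. x n + y n) \<le> l2_norm x + l2_norm y"
proof -
  have *: "(\<Sum>n\<in>F. (cmod (x n + y n))\<^sup>2) \<le> (l2_norm x + l2_norm y)\<^sup>2" if "finite F" for F
  proof -
    have "L2_set (\<lambda>n. cmod (x n + y n)) F \<le> L2_set (\<lambda>n. cmod (x n) + cmod (y n)) F"
      by (rule L2_set_mono) (auto intro: norm_triangle_ineq)
    also have "\<dots> \<le> L2_set (\<lambda>n. cmod (x n)) F + L2_set (\<lambda>n. cmod (y n)) F"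
      by (rule L2_set_triangle_ineq)
    also have "\<dots> \<le> l2_norm x + l2_norm y"
      using assms that by (intro add_mono L2_set_le_l2_norm)
    finally show ?thesis
      unfolding L2_set_def by (rule sqrt_le_D)
  qed
  show "ell2 (\<lambda>n. x n + y n)" "l2_norm (\<lambda>n. x n + y n) \<le> l2_norm x + l2_norm y"
    using ell2I_finite_sums[of "\<lambda>n. x n + y n", OF *] by auto
qed

lemma ell2_cmult:
  assumes "ell2 x"
  shows "ell2 (\<lambda>n. c * x n)" 
  using assms unfolding ell2_def by (simp add: norm_mult power_mult_distrib summable_on_cmult_right)

lemma l2_norm_cmult: "l2_norm (\<lambda>n. c * x n) = cmod c * l2_norm x"
  unfolding l2_norm_def
  by (simp add: norm_mult power_mult_distrib infsum_cmult_right' real_sqrt_mult)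

lemma ell2_cnj: "ell2 (\<lambda>n. cnj (x n)) \<longleftrightarrow> ell2 x" "l2_norm (\<lambda>n. cnj (x n)) = l2_norm x"
  by (simp_all add: ell2_def l2_norm_def)

lemma norm_le_l2_norm:
  assumes "ell2 x"
  shows "cmod (x n) \<le> l2_norm x"
  using L2_set_le_l2_norm[OF assms, of "{n}"] by simp

lemma dot_commute: "dot x y = dot y x"
  unfolding dot_def by (simp add: mult.commute)

lemma dot_add:
  assumes "ell2 x" "ell2 y" "ell2 z"
  shows "dot x (\<lambda>n. y n + z n) = dot x y + dot x z"
    and "dot (\<lambda>n. y n + z n) x = dot y x + dot z x"
proof -
  have s: "(\<lambda>n. x n * y n) summable_on UNIV" "(\<lambda>n. x n * z n) summable_on UNIV"
    by (rule abs_summable_summable, rule cauchy_schwarz_ell2; fact)+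
  show "dot x (\<lambda>n. y n + z n) = dot x y + dot x z"
    unfolding dot_def infsum_add[OF s, symmetric] by (simp add: distrib_left)
  then show "dot (\<lambda>n. y n + z n) x = dot y x + dot z x"
    by (simp only: dot_commute[of _ x])
qed

lemma dot_cmult:
  "dot x (\<lambda>n. c * y n) = c * dot x y"  "dot (\<lambda>n. c * x n) y = c * dot x y"
  unfolding dot_def infsum_cmult_right'[symmetric] by (auto intro!: infsum_cong)

type_synonym mat = "nat \<Rightarrow> nat \<Rightarrow> complex"

definition mat_apply :: "mat \<Rightarrow> (nat \<Rightarrow> complex) \<Rightarrow> nat \<Rightarrow> complex" where
  "mat_apply M x j = (\<Sum>\<^sub>\<infinity>k. M j k * x k)"

definition mat_mult :: "mat \<Rightarrow> mat \<Rightarrow> mat" where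
  "mat_mult M N j l = mat_apply M (\<lambda>k. N k l) j"

definition transp :: "mat \<Rightarrow> mat" where
  "transp M j k = M k j"

definition conj_mat :: "mat \<Rightarrow> mat" where
  "conj_mat M j k = cnj (M j k)"

text \<open>
  The hypothesis of Schur's test. It yields bounded operators on \<open>ell2\<close> and makes the double sums in
  matrix products and in pairings converge absolutely.
\<close>

definition schur :: "real \<Rightarrow> mat \<Rightarrow> bool" where
  "schur \<kappa> M \<longleftrightarrow>
     (\<forall>j. M j abs_summable_on UNIV \<and> (\<Sum>\<^sub>\<infinity>k. cmod (M j k)) \<le> \<kappa>) \<and>
     (\<forall>k. (\<lambda>j. M j k) abs_summable_on UNIV \<and> (\<Sum>\<^sub>\<infinity>j. cmod (M j k)) \<le> \<kappa>)"

lemma schur_nonneg: "schur \<kappa> M \<Longrightarrow> 0 \<le> \<kappa>"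
  unfolding schur_def by (meson infsum_nonneg norm_ge_zero order_trans)

lemma schur_transp: "schur \<kappa> M \<Longrightarrow> schur \<kappa> (transp M)"
  unfolding schur_def transp_def by auto

lemma schur_conj_mat: "schur \<kappa> M \<Longrightarrow> schur \<kappa> (conj_mat M)"
  unfolding schur_def conj_mat_def by auto

lemma schur_cmult:
  "schur \<kappa> M \<Longrightarrow> schur (cmod c * \<kappa>) (\<lambda>j k. c * M j k)"
  unfolding schur_def
  by (auto simp: norm_mult infsum_cmult_right' mult_left_mono intro: summable_on_cmult_right)

lemma schur_add:
  assumes "schur \<kappa> M" "schur \<kappa>' N"
  shows "schur (\<kappa> + \<kappa>') (\<lambda>j k. M j k + N j k)"
proof -
  have *: "(\<lambda>n. f n + g n) abs_summable_on UNIV \<and> (\<Sum>\<^sub>\<infinity>n. cmod (f n + g n)) \<le> \<kappa> + \<kappa>'"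
    if "f abs_summable_on UNIV" "(\<Sum>\<^sub>\<infinity>n. cmod (f n)) \<le> \<kappa>"
       "g abs_summable_on UNIV" "(\<Sum>\<^sub>\<infinity>n. cmod (g n)) \<le> \<kappa>'" for f g :: "nat \<Rightarrow> complex"
  proof -
    have s: "(\<lambda>n. cmod (f n) + cmod (g n)) summable_on UNIV"
      using that by (intro summable_on_add)
    then have 1: "(\<lambda>n. f n + g n) abs_summable_on UNIV"
      by (rule Infinite_Sum.abs_summable_on_comparison_test') (rule norm_triangle_ineq)
    have "(\<Sum>\<^sub>\<infinity>n. cmod (f n + g n)) \<le> (\<Sum>\<^sub>\<infinity>n. cmod (f n) + cmod (g n))"
      using 1 s by (intro infsum_mono) (auto intro: norm_triangle_ineq)
    also have "\<dots> = (\<Sum>\<^sub>\<infinity>n. cmod (f n)) + (\<Sum>\<^sub>\<infinity>n. cmod (g n))"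
      using that by (intro infsum_add)
    finally show ?thesis using 1 that by auto
  qed
  show ?thesis
    unfolding schur_def
    by (intro conjI allI; rule *[THEN conjunct1] *[THEN conjunct2]; 
        use assms in \<open>simp add: schur_def\<close>)
qed

text \<open>
  Tonelli's criterion for absolute summability of a double series.
\<close>

lemma summable_on_pairs:
  fixes f :: "'a \<Rightarrow> 'b \<Rightarrow> complex"
  assumes "\<And>x. f x abs_summable_on UNIV" "\<And>x. (\<Sum>\<^sub>\<infinity>y. cmod (f x y)) \<le> g x"
    and "g summable_on UNIV"
  shows "(\<lambda>(x,y). f x y) abs_summable_on UNIV \<times> UNIV"
proof -
  have "(\<lambda>x. infsum (\<lambda>y. cmod (f x y)) UNIV) abs_summable_on UNIV"
    by (rule Infinite_Sum.abs_summable_on_comparison_test'[OF assms(3)])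
       (use assms(2) in \<open>auto simp: infsum_nonneg\<close>)
  then show ?thesis
    using assms(1) by (subst Infinite_Sum.abs_summable_on_Sigma_iff) auto
qed

text \<open>
  Summing over the first index \<open>j\<close> of \<open>M j k\<close> first costs a factor \<open>\<kappa>\<close>; the order of summation is then
  exchanged by Tonelli's theorem.
\<close>

lemma schur_pairs:
  assumes "schur \<kappa> M" "ell2 x"
  shows "(\<lambda>(k,j). M j k * of_real ((cmod (x k))\<^sup>2)) abs_summable_on UNIV \<times> UNIV"
    and "(\<lambda>(j,k). M j k * of_real ((cmod (x k))\<^sup>2)) abs_summable_on UNIV \<times> UNIV"
    and "(\<Sum>\<^sub>\<infinity>j. \<Sum>\<^sub>\<infinity>k. cmod (M j k) * (cmod (x k))\<^sup>2) \<le> \<kappa> * (l2_norm x)\<^sup>2"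
    and "(\<lambda>j. \<Sum>\<^sub>\<infinity>k. cmod (M j k) * (cmod (x k))\<^sup>2) summable_on UNIV"
proof -
  have col: "(\<lambda>j. cmod (M j k)) summable_on UNIV" "(\<Sum>\<^sub>\<infinity>j. cmod (M j k)) \<le> \<kappa>" for k
    using assms(1) by (auto simp: schur_def)
  have s2: "(\<lambda>k. \<kappa> * (cmod (x k))\<^sup>2) summable_on UNIV"
    using assms(2) by (auto simp: ell2_def intro: summable_on_cmult_right)
  have bd: "(\<Sum>\<^sub>\<infinity>j. cmod (M j k) * (cmod (x k))\<^sup>2) \<le> \<kappa> * (cmod (x k))\<^sup>2" for k
    by (simp add: infsum_cmult_left' mult_right_mono col)
  show 1: "(\<lambda>(k,j). M j k * of_real ((cmod (x k))\<^sup>2)) abs_summable_on UNIV \<times> UNIV"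
  proof (rule summable_on_pairs[OF _ _ s2])
    show "(\<lambda>j. M j k * of_real ((cmod (x k))\<^sup>2)) abs_summable_on UNIV" for k
      using col by (auto simp: norm_mult norm_power intro!: summable_on_cmult_left)
    show "(\<Sum>\<^sub>\<infinity>j. cmod (M j k * of_real ((cmod (x k))\<^sup>2))) \<le> \<kappa> * (cmod (x k))\<^sup>2" for k
      using bd by (simp add: norm_mult norm_power)
  qed
  show 2: "(\<lambda>(j,k). M j k * of_real ((cmod (x k))\<^sup>2)) abs_summable_on UNIV \<times> UNIV"
    using summable_on_swap[of "\<lambda>(k,j). cmod (M j k * of_real ((cmod (x k))\<^sup>2))" UNIV UNIV] 1
    by (simp add: case_prod_unfold)
  from 1 have one': "(\<lambda>(k,j). cmod (M j k) * (cmod (x k))\<^sup>2) summable_on UNIV \<times> UNIV"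
    by (simp add: norm_mult norm_power case_prod_unfold)
  from 2 have two': "(\<lambda>(j,k). cmod (M j k) * (cmod (x k))\<^sup>2) summable_on UNIV \<times> UNIV"
    by (simp add: norm_mult norm_power case_prod_unfold)
  show "(\<lambda>j. \<Sum>\<^sub>\<infinity>k. cmod (M j k) * (cmod (x k))\<^sup>2) summable_on UNIV"
    using summable_on_Sigma_banach[OF two'] by simp
  have "(\<Sum>\<^sub>\<infinity>j. \<Sum>\<^sub>\<infinity>k. cmod (M j k) * (cmod (x k))\<^sup>2)
      = (\<Sum>\<^sub>\<infinity>k. \<Sum>\<^sub>\<infinity>j. cmod (M j k) * (cmod (x k))\<^sup>2)"
    by (rule infsum_swap_banach[OF two'])
  also have "\<dots> \<le> (\<Sum>\<^sub>\<infinity>k. \<kappa> * (cmod (x k))\<^sup>2)"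
    using bd s2 summable_on_Sigma_banach[OF one'] by (intro infsum_mono) auto
  also have "\<dots> = \<kappa> * (l2_norm x)\<^sup>2"
    by (simp add: l2_norm_power2 infsum_cmult_right')
  finally show "(\<Sum>\<^sub>\<infinity>j. \<Sum>\<^sub>\<infinity>k. cmod (M j k) * (cmod (x k))\<^sup>2) \<le> \<kappa> * (l2_norm x)\<^sup>2" .
qed

lemma cmult_bounded_abs_summable:
  fixes f g :: "nat \<Rightarrow> complex"
  assumes "f abs_summable_on UNIV" "\<And>n. cmod (g n) \<le> B"
  shows "(\<lambda>n. f n * g n) abs_summable_on UNIV"
    and "(\<Sum>\<^sub>\<infinity>n. cmod (f n * g n)) \<le> (\<Sum>\<^sub>\<infinity>n. cmod (f n)) * B"
proof -
  have s: "(\<lambda>n. cmod (f n) * B) summable_on UNIV"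
    using assms(1) by (intro summable_on_cmult_left)
  have le: "cmod (f n * g n) \<le> cmod (f n) * B" for n
    using assms(2)[of n] by (simp add: norm_mult mult_left_mono)
  show 1: "(\<lambda>n. f n * g n) abs_summable_on UNIV"
    using s le by (rule Infinite_Sum.abs_summable_on_comparison_test')
  show "(\<Sum>\<^sub>\<infinity>n. cmod (f n * g n)) \<le> (\<Sum>\<^sub>\<infinity>n. cmod (f n)) * B"
    unfolding infsum_cmult_left'[symmetric] using 1 s le by (rule infsum_mono)
qed

text \<open>
  Schur's test.
\<close>

lemma schur_mat_apply:
  assumes M: "schur \<kappa> M" and x: "ell2 x"
  shows "ell2 (mat_apply M x)" "l2_norm (mat_apply M x) \<le> \<kappa> * l2_norm x"
proof -
  have k0: "\<kappa> \<ge> 0" using M by (rule schur_nonneg)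
  have row: "M j abs_summable_on UNIV" "(\<Sum>\<^sub>\<infinity>k. cmod (M j k)) \<le> \<kappa>" for j
    using M by (auto simp: schur_def)
  define w where "w j = (\<Sum>\<^sub>\<infinity>k. cmod (M j k) * (cmod (x k))\<^sup>2)" for j
  have w: "w summable_on UNIV" "infsum w UNIV \<le> \<kappa> * (l2_norm x)\<^sup>2"
    using schur_pairs[OF M x] unfolding w_def by auto
  have w0: "0 \<le> w j" for j unfolding w_def by (simp add: infsum_nonneg)
  have wk: "(\<lambda>k. cmod (M j k) * (cmod (x k))\<^sup>2) summable_on UNIV" for j
  proof -
    have "(\<lambda>k. M j k * of_real ((cmod (x k))\<^sup>2)) abs_summable_on UNIV"
      by (rule cmult_bounded_abs_summable[OF row(1), where B="(l2_norm x)\<^sup>2"])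
         (use norm_le_l2_norm[OF x] in \<open>auto simp: norm_power intro: power_mono\<close>)
    then show ?thesis by (simp add: norm_mult norm_power)
  qed
  have pt: "(cmod (mat_apply M x j))\<^sup>2 \<le> \<kappa> * w j" for j
  proof -
    have s1: "(\<lambda>k. M j k * x k) abs_summable_on UNIV"
      using cmult_bounded_abs_summable(1)[OF row(1)] norm_le_l2_norm[OF x] by blast
    \<comment> \<open>The entry is split as a product of two square roots, and only one of them is kept with \<open>x k\<close>.\<close>
    define p q where "p k = complex_of_real (sqrt (cmod (M j k)))"
      and "q k = complex_of_real (sqrt (cmod (M j k)) * cmod (x k))" for k
    have p: "ell2 p" "(l2_norm p)\<^sup>2 \<le> \<kappa>"
      unfolding ell2_def l2_norm_power2 p_def using row by (auto simp: power2_eq_square)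
    have q: "ell2 q" "(l2_norm q)\<^sup>2 = w j"
      unfolding ell2_def l2_norm_power2 q_def w_def using wk
      by (auto simp: power_mult_distrib norm_mult)
    have "cmod (mat_apply M x j) \<le> (\<Sum>\<^sub>\<infinity>k. cmod (M j k * x k))"
      unfolding mat_apply_def by (rule norm_infsum_bound[OF s1])
    also have "\<dots> = (\<Sum>\<^sub>\<infinity>k. cmod (p k * q k))"
      by (simp add: p_def q_def norm_mult mult.assoc[symmetric])
    also have "\<dots> \<le> l2_norm p * l2_norm q"
      using p q by (intro cauchy_schwarz_ell2)
    finally have "(cmod (mat_apply M x j))\<^sup>2 \<le> (l2_norm p * l2_norm q)\<^sup>2"
      by (intro power_mono) auto
    also have "\<dots> = (l2_norm p)\<^sup>2 * w j" by (simp add: power_mult_distrib q)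
    also have "\<dots> \<le> \<kappa> * w j"
      using p(2) q(2)[symmetric] by (intro mult_right_mono) auto
    finally show ?thesis .
  qed
  have sum: "(\<Sum>j\<in>F. (cmod (mat_apply M x j))\<^sup>2) \<le> (\<kappa> * l2_norm x)\<^sup>2" if "finite F" for F
  proof -
    have "(\<Sum>j\<in>F. (cmod (mat_apply M x j))\<^sup>2) \<le> \<kappa> * (\<Sum>j\<in>F. w j)"
      unfolding sum_distrib_left by (intro sum_mono pt)
    also have "\<dots> \<le> \<kappa> * infsum w UNIV"
      using k0 w(1) that
      by (intro mult_left_mono finite_sum_le_infsum) (auto simp: w0)
    also have "\<dots> \<le> \<kappa> * (\<kappa> * (l2_norm x)\<^sup>2)"
      using w(2) k0 by (intro mult_left_mono)
    finally show ?thesis by (simp add: power_mult_distrib power2_eq_square mult_ac)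
  qed
  show "ell2 (mat_apply M x)" "l2_norm (mat_apply M x) \<le> \<kappa> * l2_norm x"
    using ell2I_finite_sums[of "mat_apply M x" "\<kappa> * l2_norm x", OF sum] k0 by auto
qed

lemma schur_form_summable:
  assumes M: "schur \<kappa> M" and "ell2 f" "ell2 x"
  shows "(\<lambda>(j,k). f j * M j k * x k) abs_summable_on UNIV \<times> UNIV"
proof -
  have 1: "(\<lambda>(j,k). cmod (M j k * of_real ((cmod (x k))\<^sup>2))) summable_on UNIV \<times> UNIV"
    using schur_pairs(2)[OF M \<open>ell2 x\<close>] by (simp add: case_prod_unfold)
  have 2: "(\<lambda>(j,k). cmod (M j k * of_real ((cmod (f j))\<^sup>2))) summable_on UNIV \<times> UNIV"
    using schur_pairs(1)[OF schur_transp[OF M] \<open>ell2 f\<close>] by (simp add: case_prod_unfold transp_def)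
  have "(\<lambda>p. cmod (M (fst p) (snd p) * of_real ((cmod (x (snd p)))\<^sup>2))
           + cmod (M (fst p) (snd p) * of_real ((cmod (f (fst p)))\<^sup>2))) summable_on UNIV \<times> UNIV"
    using summable_on_add[OF 1 2] by (simp add: case_prod_unfold)
  moreover have "cmod (f j * M j k * x k) \<le>
     cmod (M j k * of_real ((cmod (x k))\<^sup>2)) + cmod (M j k * of_real ((cmod (f j))\<^sup>2))" for j k
  proof -
    have "cmod (f j) * cmod (x k) \<le> (cmod (x k))\<^sup>2 + (cmod (f j))\<^sup>2"
      using sum_squares_bound[of "cmod (f j)" "cmod (x k)"]
        mult_nonneg_nonneg[OF norm_ge_zero[of "f j"] norm_ge_zero[of "x k"]]
      by (simp only: mult.assoc)
    then have "cmod (M j k) * (cmod (f j) * cmod (x k))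
        \<le> cmod (M j k) * ((cmod (x k))\<^sup>2 + (cmod (f j))\<^sup>2)"
      by (intro mult_left_mono) auto
    then show ?thesis by (simp add: norm_mult norm_power algebra_simps)
  qed
  ultimately show ?thesis
    by (intro Infinite_Sum.abs_summable_on_comparison_test'[where g = "\<lambda>p. cmod (M (fst p) (snd p) * of_real ((cmod (x (snd p)))\<^sup>2))
           + cmod (M (fst p) (snd p) * of_real ((cmod (f (fst p)))\<^sup>2))"]) auto
qed

lemma dot_mat_apply:
  assumes M: "schur \<kappa> M" and "ell2 f" "ell2 x"
  shows "dot f (mat_apply M x) = dot (mat_apply (transp M) f) x"
proof -
  have s: "(\<lambda>(j,k). f j * M j k * x k) summable_on UNIV \<times> UNIV"
    using schur_form_summable[OF assms] by (rule abs_summable_summable)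
  have "dot f (mat_apply M x) = (\<Sum>\<^sub>\<infinity>j. \<Sum>\<^sub>\<infinity>k. f j * M j k * x k)"
    unfolding dot_def mat_apply_def infsum_cmult_right'[symmetric] by (simp add: mult.assoc)
  also have "\<dots> = (\<Sum>\<^sub>\<infinity>k. \<Sum>\<^sub>\<infinity>j. f j * M j k * x k)"
    by (rule infsum_swap_banach[OF s])
  also have "\<dots> = dot (mat_apply (transp M) f) x"
    unfolding dot_def mat_apply_def infsum_cmult_left'[symmetric]  by (simp add: transp_def mult_ac)
  finally show ?thesis .
qed

lemma mat_mult_summable:
  assumes M: "schur \<kappa> M" and N: "schur \<kappa>' N" and x: "\<And>l. cmod (x l) \<le> B"
  shows "(\<lambda>(k,l). M j k * N k l * x l) abs_summable_on UNIV \<times> UNIV"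
    and "(\<Sum>\<^sub>\<infinity>k. \<Sum>\<^sub>\<infinity>l. cmod (M j k * N k l * x l)) \<le> \<kappa> * (\<kappa>' * B)"
proof -
  have B: "B \<ge> 0" using x[of 0] norm_ge_zero order_trans by blast
  have k': "\<kappa>' \<ge> 0" using N by (rule schur_nonneg)
  have row: "N k abs_summable_on UNIV" "(\<Sum>\<^sub>\<infinity>l. cmod (N k l)) \<le> \<kappa>'" for k
    using N by (auto simp: schur_def)
  have rowM: "M j abs_summable_on UNIV" "(\<Sum>\<^sub>\<infinity>k. cmod (M j k)) \<le> \<kappa>"
    using M by (auto simp: schur_def)
  have s: "(\<lambda>l. N k l * x l) abs_summable_on UNIV" "(\<Sum>\<^sub>\<infinity>l. cmod (N k l * x l)) \<le> \<kappa>' * B" for k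
    using cmult_bounded_abs_summable[OF row(1)[of k], of x, OF x] mult_right_mono[OF row(2)[of k] B] by auto
  have s2: "(\<lambda>k. cmod (M j k) * (\<kappa>' * B)) summable_on UNIV"
    using rowM by (intro summable_on_cmult_left) auto
  have eq: "(\<Sum>\<^sub>\<infinity>l. cmod (M j k * N k l * x l)) = cmod (M j k) * (\<Sum>\<^sub>\<infinity>l. cmod (N k l * x l))" for k
    unfolding infsum_cmult_right'[symmetric] by (simp add: norm_mult mult_ac)
  have le: "(\<Sum>\<^sub>\<infinity>l. cmod (M j k * N k l * x l)) \<le> cmod (M j k) * (\<kappa>' * B)" for k
    unfolding eq using s by (intro mult_left_mono) auto
  show 1: "(\<lambda>(k,l). M j k * N k l * x l) abs_summable_on UNIV \<times> UNIV"
  proof (rule summable_on_pairs[OF _ le s2])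
    show "(\<lambda>l. M j k * N k l * x l) abs_summable_on UNIV" for k
      using summable_on_cmult_right[OF s(1)[of k], of "cmod (M j k)"]
      by (simp add: norm_mult mult_ac)
  qed
  have 2: "(\<lambda>(k,l). cmod (M j k * N k l * x l)) summable_on UNIV \<times> UNIV"
    using 1 by (simp add: case_prod_unfold)
  have "(\<Sum>\<^sub>\<infinity>k. \<Sum>\<^sub>\<infinity>l. cmod (M j k * N k l * x l)) \<le> (\<Sum>\<^sub>\<infinity>k. cmod (M j k) * (\<kappa>' * B))"
    using le s2 summable_on_Sigma_banach[OF 2] by (intro infsum_mono) auto
  also have "\<dots> \<le> \<kappa> * (\<kappa>' * B)"
    unfolding infsum_cmult_left' using rowM k' B by (intro mult_right_mono) auto
  finally show "(\<Sum>\<^sub>\<infinity>k. \<Sum>\<^sub>\<infinity>l. cmod (M j k * N k l * x l)) \<le> \<kappa> * (\<kappa>' * B)" .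
qed

lemma mat_apply_mat_mult:
  assumes M: "schur \<kappa> M" and N: "schur \<kappa>' N" and x: "ell2 x"
  shows "mat_apply (mat_mult M N) x = mat_apply M (mat_apply N x)"
proof
  fix j
  have s: "(\<lambda>(k,l). M j k * N k l * x l) summable_on UNIV \<times> UNIV"
    using mat_mult_summable(1)[OF M N norm_le_l2_norm[OF x]] by (rule abs_summable_summable)
  have "mat_apply M (mat_apply N x) j = (\<Sum>\<^sub>\<infinity>k. \<Sum>\<^sub>\<infinity>l. M j k * N k l * x l)"
    unfolding mat_apply_def infsum_cmult_right'[symmetric] by (simp add: mult.assoc)
  also have "\<dots> = (\<Sum>\<^sub>\<infinity>l. \<Sum>\<^sub>\<infinity>k. M j k * N k l * x l)"
    by (rule infsum_swap_banach[OF s])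
  also have "\<dots> = mat_apply (mat_mult M N) x j"
    unfolding mat_mult_def mat_apply_def infsum_cmult_left'[symmetric] ..
  finally show "mat_apply (mat_mult M N) x j = mat_apply M (mat_apply N x) j" ..
qed

lemma transp_mat_mult: "transp (mat_mult M N) = mat_mult (transp N) (transp M)"
  by (intro ext) (simp add: transp_def mat_mult_def mat_apply_def mult.commute)

lemma schur_mat_mult:
  assumes M: "schur \<kappa> M" and N: "schur \<kappa>' N"
  shows "schur (\<kappa> * \<kappa>') (mat_mult M N)"
proof -
  have *: "mat_mult M N j abs_summable_on UNIV \<and> (\<Sum>\<^sub>\<infinity>l. cmod (mat_mult M N j l)) \<le> \<kappa> * \<kappa>'"
    if M: "schur \<kappa> M" and N: "schur \<kappa>' N" for \<kappa> \<kappa>' M N j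
  proof -
    have s: "(\<lambda>(k,l). cmod (M j k * N k l)) summable_on UNIV \<times> UNIV"
       "(\<Sum>\<^sub>\<infinity>k. \<Sum>\<^sub>\<infinity>l. cmod (M j k * N k l)) \<le> \<kappa> * \<kappa>'"
      using mat_mult_summable[OF M N, of "\<lambda>_. 1" 1 j] by (auto simp: case_prod_unfold)
    have s': "(\<lambda>(l,k). cmod (M j k * N k l)) summable_on UNIV \<times> UNIV"
      using summable_on_swap[of "\<lambda>(k,l). cmod (M j k * N k l)" UNIV UNIV] s(1)
      by (simp add: case_prod_unfold)
    have 3: "(\<lambda>l. \<Sum>\<^sub>\<infinity>k. cmod (M j k * N k l)) summable_on UNIV"
      using summable_on_Sigma_banach[OF s'] by simp
    have le: "cmod (mat_mult M N j l) \<le> (\<Sum>\<^sub>\<infinity>k. cmod (M j k * N k l))" for l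
      unfolding mat_mult_def mat_apply_def
      by (rule norm_infsum_bound) (use summable_on_SigmaD1[OF s'] in auto)
    have 1: "mat_mult M N j abs_summable_on UNIV"
      using 3 le by (rule Infinite_Sum.abs_summable_on_comparison_test')
    moreover have "(\<Sum>\<^sub>\<infinity>l. cmod (mat_mult M N j l)) \<le> (\<Sum>\<^sub>\<infinity>l. \<Sum>\<^sub>\<infinity>k. cmod (M j k * N k l))"
      using 1 3 le by (rule infsum_mono)
    moreover have "\<dots> = (\<Sum>\<^sub>\<infinity>k. \<Sum>\<^sub>\<infinity>l. cmod (M j k * N k l))"
      by (rule infsum_swap_banach[OF s'])
    ultimately show ?thesis using s(2) by auto
  qed
  have col: "mat_mult (transp N) (transp M) l = (\<lambda>j. mat_mult M N j l)" for l
    by (simp flip: transp_mat_mult, simp add: transp_def fun_eq_iff)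
  show ?thesis
    unfolding schur_def
    using *[OF M N] *[OF schur_transp[OF N] schur_transp[OF M], unfolded col]
    by (simp add: mult.commute)
qed

text \<open>
  The form is minus its own conjugate.
\<close>

lemma skew_form_zero:
  assumes C: "schur \<kappa> C" and skew: "\<And>j k. C k j = - cnj (C j k)" and x: "ell2 x"
  shows "Re (dot (\<lambda>n. cnj (x n)) (mat_apply C x)) = 0"
proof -
  have x': "ell2 (\<lambda>n. cnj (x n))" using x by (simp add: ell2_cnj)
  have trC: "mat_apply (transp C) (\<lambda>n. cnj (x n)) = (\<lambda>j. - cnj (mat_apply C x j))"
  proof
    fix j
    have "mat_apply (transp C) (\<lambda>n. cnj (x n)) j = (\<Sum>\<^sub>\<infinity>k. - cnj (C j k * x k))"
      unfolding mat_apply_def transp_def by (intro infsum_cong) (subst skew, simp)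
    then show "mat_apply (transp C) (\<lambda>n. cnj (x n)) j = - cnj (mat_apply C x j)"
      unfolding infsum_uminus infsum_cnj mat_apply_def .
  qed
  have "dot (\<lambda>n. cnj (x n)) (mat_apply C x) = dot (\<lambda>j. - cnj (mat_apply C x j)) x"
    using dot_mat_apply[OF C x' x] by (simp add: trC)
  also have "\<dots> = - cnj (dot (\<lambda>n. cnj (x n)) (mat_apply C x))"
    unfolding dot_def infsum_cnj[symmetric] infsum_uminus[symmetric]
    by (intro infsum_cong) simp
  finally show ?thesis by (simp add: complex_eq_iff)
qed

text \<open>
  The term of first order in \<open>h\<close> is \<open>2 h Re (x, C x)\<close>, which vanishes for skew-adjoint \<open>C\<close>. An explicit Euler
  step for a unitary flow thus changes norms to second order only.
\<close>

lemma l2_norm_skew_step: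
  assumes C: "schur \<kappa> C" and skew: "\<And>j k. C k j = - cnj (C j k)" and x: "ell2 x"
  shows "(l2_norm (\<lambda>n. x n + of_real h * mat_apply C x n))\<^sup>2 \<le> (1 + h\<^sup>2 * \<kappa>\<^sup>2) * (l2_norm x)\<^sup>2"
proof -
  let ?y = "mat_apply C x"
  have y: "ell2 ?y" "l2_norm ?y \<le> \<kappa> * l2_norm x" using schur_mat_apply[OF C x] .
  have x': "ell2 (\<lambda>n. cnj (x n))" using x by (simp add: ell2_cnj)
  have s: "(\<lambda>n. cnj (x n) * ?y n) summable_on UNIV"
    using cauchy_schwarz_ell2(1)[OF x' y(1)] by (rule abs_summable_summable)
  have pt: "(cmod (x n + of_real h * ?y n))\<^sup>2 =
      (cmod (x n))\<^sup>2 + h\<^sup>2 * (cmod (?y n))\<^sup>2 + 2 * h * Re (cnj (x n) * ?y n)" for n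
    unfolding cmod_power2 by (simp add: algebra_simps power2_eq_square)
  have s1: "(\<lambda>n. (cmod (x n))\<^sup>2) summable_on UNIV" using x by (simp add: ell2_def)
  have s2: "(\<lambda>n. h\<^sup>2 * (cmod (?y n))\<^sup>2) summable_on UNIV"
    using y by (auto simp: ell2_def intro: summable_on_cmult_right)
  have s3: "(\<lambda>n. 2 * h * Re (cnj (x n) * ?y n)) summable_on UNIV"
    by (intro summable_on_cmult_right summable_on_Re[OF s])
  have "(l2_norm (\<lambda>n. x n + of_real h * ?y n))\<^sup>2 =
      (l2_norm x)\<^sup>2 + h\<^sup>2 * (l2_norm ?y)\<^sup>2 + 2 * h * Re (dot (\<lambda>n. cnj (x n)) ?y)"
    unfolding l2_norm_power2 pt dot_def infsum_Re[OF s, symmetric] infsum_cmult_right'[symmetric]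
    by (subst infsum_add[OF summable_on_add[OF s1 s2] s3], subst infsum_add[OF s1 s2]) simp
  also have "\<dots> = (l2_norm x)\<^sup>2 + h\<^sup>2 * (l2_norm ?y)\<^sup>2"
    using skew_form_zero[OF C skew x] by simp
  also have "\<dots> \<le> (l2_norm x)\<^sup>2 + h\<^sup>2 * (\<kappa> * l2_norm x)\<^sup>2"
    using y by (intro add_left_mono mult_left_mono power_mono) auto
  finally show ?thesis by (simp add: algebra_simps power_mult_distrib)
qed

section \<open>The cubic nonlinearity and its Lax pair\<close>

definition l1_norm :: "(nat \<Rightarrow> complex) \<Rightarrow> real" where
  "l1_norm a = (\<Sum>\<^sub>\<infinity>n. cmod (a n))"

text \<open>
  The matrix, in the basis of powers of \<open>z\<close>, of the antilinear Hankel operator \<open>h \<mapsto> \<Pi>(u \<cdot> cnj h)\<close>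
  followed by the backward shift. The shift removes the coefficient \<open>a 0\<close>, on which the perturbation acts.
\<close>

definition hankel :: "(nat \<Rightarrow> complex) \<Rightarrow> mat" where
  "hankel a j k = a (j + k + 1)"

text \<open>
  The matrix of multiplication by \<open>u\<close> on \<open>L\<^sup>2\<^sub>+\<close>.
\<close>

definition lower_toeplitz :: "(nat \<Rightarrow> complex) \<Rightarrow> mat" where
  "lower_toeplitz a j k = (if k \<le> j then a (j - k) else 0)"

text \<open>
  \<open>L L\<^sup>*\<close> for the lower triangular Toeplitz matrix \<open>L\<close>.
\<close>

definition toeplitz_square :: "(nat \<Rightarrow> complex) \<Rightarrow> mat" where
  "toeplitz_square a = mat_mult (lower_toeplitz a) (conj_mat (transp (lower_toeplitz a)))"

text \<open>
  \<open>G G\<^sup>*\<close> for the Hankel matrix \<open>G\<close>; as \<open>G\<close> is symmetric, its adjoint is its entrywise conjugate.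
\<close>

definition hankel_square :: "(nat \<Rightarrow> complex) \<Rightarrow> mat" where
  "hankel_square a = mat_mult (hankel a) (conj_mat (hankel a))"

text \<open>
  The index of the conjugated factor, \<open>q = p + r - n\<close>, is determined by \<open>p\<close> and \<open>r\<close>; the condition
  \<open>n \<le> p + r\<close> says that \<open>q\<close> is a natural number.
\<close>

definition cubic_term :: "(nat \<Rightarrow> complex) \<Rightarrow> nat \<Rightarrow> nat \<times> nat \<Rightarrow> complex" where
  "cubic_term a n = (\<lambda>(p, r). a p * a r * (if n \<le> p + r then cnj (a (p + r - n)) else 0))"

text \<open>
  The coefficients of \<open>\<Pi>(\<bar>u\<bar>\<^sup>2 u)\<close>.
\<close>

definition cubic :: "(nat \<Rightarrow> complex) \<Rightarrow> nat \<Rightarrow> complex" where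
  "cubic a n = infsum (cubic_term a n) UNIV"

lemma l1_norm_nonneg: "l1_norm a \<ge> 0"
  unfolding l1_norm_def by (simp add: infsum_nonneg)

lemma abs_summable_bounded:
  assumes a: "a abs_summable_on UNIV"
  shows "cmod (a k) \<le> l1_norm a"
  using finite_sum_le_infsum[OF a, of "{k}"] by (simp add: l1_norm_def)

lemma abs_summable_inj:
  fixes a :: "nat \<Rightarrow> complex"
  assumes "a abs_summable_on UNIV" "inj_on h A"
  shows "(\<lambda>k. a (h k)) abs_summable_on A" "(\<Sum>\<^sub>\<infinity>k\<in>A. cmod (a (h k))) \<le> l1_norm a"
proof -
  have s: "(\<lambda>n. cmod (a n)) summable_on h ` A"
    using assms(1) by (rule summable_on_subset_banach) simp
  then show "(\<lambda>k. a (h k)) abs_summable_on A"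
    using summable_on_reindex[OF assms(2), of "\<lambda>n. cmod (a n)"] by (simp add: o_def)
  have "(\<Sum>\<^sub>\<infinity>k\<in>A. cmod (a (h k))) = (\<Sum>\<^sub>\<infinity>n\<in>h ` A. cmod (a n))"
    using infsum_reindex[OF assms(2), of "\<lambda>n. cmod (a n)"] by (simp add: o_def)
  also have "\<dots> \<le> l1_norm a"
    unfolding l1_norm_def by (rule infsum_mono2) (use s assms in auto)
  finally show "(\<Sum>\<^sub>\<infinity>k\<in>A. cmod (a (h k))) \<le> l1_norm a" .
qed

lemma schur_hankel: "a abs_summable_on UNIV \<Longrightarrow> schur (l1_norm a) (hankel a)"
  unfolding schur_def hankel_def
  using abs_summable_inj[of a "\<lambda>k. j + k + 1" UNIV for j] abs_summable_inj[of a "\<lambda>j. j + k + 1" UNIV for k]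
  by (auto simp: inj_on_def)

lemma schur_lower_toeplitz:
  assumes a: "a abs_summable_on UNIV"
  shows "schur (l1_norm a) (lower_toeplitz a)"
proof -
  have row: "lower_toeplitz a j abs_summable_on UNIV \<and> (\<Sum>\<^sub>\<infinity>k. cmod (lower_toeplitz a j k)) \<le> l1_norm a" for j
  proof -
    have i: "inj_on (\<lambda>k. j - k) {..j}" by (auto simp: inj_on_def)
    have "lower_toeplitz a j abs_summable_on UNIV \<longleftrightarrow> (\<lambda>k. cmod (a (j - k))) summable_on {..j}"
      by (rule summable_on_cong_neutral) (auto simp: lower_toeplitz_def)
    moreover have "(\<Sum>\<^sub>\<infinity>k. cmod (lower_toeplitz a j k)) = (\<Sum>\<^sub>\<infinity>k\<in>{..j}. cmod (a (j - k)))"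
      by (rule infsum_cong_neutral) (auto simp: lower_toeplitz_def)
    ultimately show ?thesis using abs_summable_inj[OF a i] by simp
  qed
  have col: "(\<lambda>j. lower_toeplitz a j k) abs_summable_on UNIV \<and> (\<Sum>\<^sub>\<infinity>j. cmod (lower_toeplitz a j k)) \<le> l1_norm a" for k
  proof -
    have i: "inj_on (\<lambda>j. j - k) {k..}" by (auto simp: inj_on_def)
    have "(\<lambda>j. lower_toeplitz a j k) abs_summable_on UNIV \<longleftrightarrow> (\<lambda>j. cmod (a (j - k))) summable_on {k..}"
      by (rule summable_on_cong_neutral) (auto simp: lower_toeplitz_def)
    moreover have "(\<Sum>\<^sub>\<infinity>j. cmod (lower_toeplitz a j k)) = (\<Sum>\<^sub>\<infinity>j\<in>{k..}. cmod (a (j - k)))"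
      by (rule infsum_cong_neutral) (auto simp: lower_toeplitz_def)
    ultimately show ?thesis using abs_summable_inj[OF a i] by simp
  qed
  show ?thesis unfolding schur_def using row col by blast
qed

lemma schur_toeplitz_square: "a abs_summable_on UNIV \<Longrightarrow> schur ((l1_norm a)\<^sup>2) (toeplitz_square a)"
  and schur_hankel_square: "a abs_summable_on UNIV \<Longrightarrow> schur ((l1_norm a)\<^sup>2) (hankel_square a)"
  unfolding toeplitz_square_def hankel_square_def power2_eq_square
  by (intro schur_mat_mult schur_lower_toeplitz schur_hankel schur_conj_mat schur_transp; simp)+

lemma mat_mult_adjoint_hermitian:
  "mat_mult M (conj_mat (transp M)) k j = cnj (mat_mult M (conj_mat (transp M)) j k)"
  unfolding mat_mult_def mat_apply_def infsum_cnj[symmetric]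
  by (intro infsum_cong) (simp add: conj_mat_def transp_def mult.commute)

lemma transp_hankel: "transp (hankel a) = hankel a"
  by (intro ext) (simp add: transp_def hankel_def add_ac)

lemma toeplitz_square_hermitian: "toeplitz_square a k j = cnj (toeplitz_square a j k)"
  unfolding toeplitz_square_def by (rule mat_mult_adjoint_hermitian)

lemma hankel_square_hermitian: "hankel_square a k j = cnj (hankel_square a j k)"
  using mat_mult_adjoint_hermitian[of "hankel a" k j] unfolding hankel_square_def transp_hankel .

lemma cubic_term_summable:
  assumes a: "a abs_summable_on UNIV"
  shows "cubic_term a n abs_summable_on UNIV"
proof -
  note bd = abs_summable_bounded[OF a]
  let ?f = "\<lambda>p r. a p * a r * (if n \<le> p + r then cnj (a (p + r - n)) else 0)"
  have g: "(\<lambda>p. cmod (a p) * (l1_norm a * l1_norm a)) summable_on UNIV"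
    using a by (intro summable_on_cmult_left)
  have r: "?f p abs_summable_on UNIV" "(\<Sum>\<^sub>\<infinity>r. cmod (?f p r)) \<le> cmod (a p) * (l1_norm a * l1_norm a)" for p
  proof -
    let ?h = "\<lambda>r. a p * (if n \<le> p + r then cnj (a (p + r - n)) else 0)"
    have b: "cmod (?h r) \<le> cmod (a p) * l1_norm a" for r
      using bd[of "p + r - n"] l1_norm_nonneg[of a] by (auto simp: norm_mult mult_left_mono)
    have eq: "?f p r = a r * ?h r" for r by simp
    show "?f p abs_summable_on UNIV" "(\<Sum>\<^sub>\<infinity>r. cmod (?f p r)) \<le> cmod (a p) * (l1_norm a * l1_norm a)"
      using cmult_bounded_abs_summable[OF a, of ?h, OF b] unfolding eq
      by (simp_all add: l1_norm_def mult_ac)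
  qed
  show ?thesis
    using summable_on_pairs[of ?f, OF r g] by (simp add: cubic_term_def)
qed

text \<open>
  With \<open>k\<close> positive this computes a column of \<open>P G\<close>, with \<open>k = 0\<close> the vector \<open>P a\<close>. Writing the summation
  indices of the matrix products as \<open>m\<close> and \<open>l\<close>, the substitution is \<open>p = j - l\<close>, \<open>r = m + k\<close>, \<open>q = m - l\<close>.
\<close>

lemma mat_apply_toeplitz_square_shift:
  assumes a: "a abs_summable_on UNIV"
  shows "mat_apply (toeplitz_square a) (\<lambda>m. a (m + k)) j = infsum (cubic_term a (j + k)) {(p, r). p \<le> j \<and> k \<le> r}"
proof -
  let ?g = "\<lambda>(m, l). lower_toeplitz a j l * cnj (lower_toeplitz a m l) * a (m + k)"
  let ?S = "{(p, r). p \<le> j \<and> k \<le> r \<and> j + k \<le> p + r}"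
  let ?T = "{(m, l). l \<le> j \<and> l \<le> m}"
  have "(cubic_term a (j + k) has_sum infsum (cubic_term a (j + k)) ?S) ?S"
    by (intro has_sum_infsum summable_on_subset_banach[OF abs_summable_summable[OF cubic_term_summable[OF a]]]) simp
  moreover have "(?g has_sum infsum (cubic_term a (j + k)) ?S) ?T \<longleftrightarrow> (cubic_term a (j + k) has_sum infsum (cubic_term a (j + k)) ?S) ?S"
    by (rule has_sum_reindex_bij_witness[where j = "\<lambda>(m, l). (j - l, m + k)" and i = "\<lambda>(p, r). (r - k, j - p)"])
       (auto simp: lower_toeplitz_def cubic_term_def mult_ac)
  ultimately have "(?g has_sum infsum (cubic_term a (j + k)) ?S) ?T" by simp
  then have g: "(?g has_sum infsum (cubic_term a (j + k)) ?S) (UNIV \<times> UNIV)"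
    by (rule has_sum_cong_neutral[THEN iffD1, rotated -1]) (auto simp: lower_toeplitz_def split: if_splits)
  have "mat_apply (toeplitz_square a) (\<lambda>m. a (m + k)) j = (\<Sum>\<^sub>\<infinity>m. \<Sum>\<^sub>\<infinity>l. ?g (m, l))"
    unfolding mat_apply_def toeplitz_square_def mat_mult_def infsum_cmult_left'[symmetric] by (simp add: conj_mat_def transp_def)
  also have "\<dots> = infsum ?g (UNIV \<times> UNIV)"
    using infsum_Sigma'_banach[of "\<lambda>m l. ?g (m, l)" UNIV "\<lambda>_. UNIV"] g
    by (auto simp: has_sum_imp_summable case_prod_unfold)
  also have "\<dots> = infsum (cubic_term a (j + k)) ?S" by (rule infsumI[OF g])
  also have "\<dots> = infsum (cubic_term a (j + k)) {(p, r). p \<le> j \<and> k \<le> r}"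
    by (rule infsum_cong_neutral) (auto simp: cubic_term_def split: if_splits)
  finally show ?thesis .
qed

text \<open>
  Here the substitution is \<open>p = j + l + 1\<close>, \<open>r = m + k\<close>, \<open>q = l + m + 1\<close>, so exactly the range \<open>p > j\<close> that
  the Toeplitz part misses is covered.
\<close>

lemma mat_apply_hankel_square_shift:
  assumes a: "a abs_summable_on UNIV"
  shows "mat_apply (hankel_square a) (\<lambda>m. a (m + k)) j = infsum (cubic_term a (j + k)) {(p, r). j < p \<and> k \<le> r}"
proof -
  let ?g = "\<lambda>(m, l). a (j + l + 1) * cnj (a (l + m + 1)) * a (m + k)"
  let ?S = "{(p, r). j < p \<and> k \<le> r}"
  have "(cubic_term a (j + k) has_sum infsum (cubic_term a (j + k)) ?S) ?S"
    by (intro has_sum_infsum summable_on_subset_banach[OF abs_summable_summable[OF cubic_term_summable[OF a]]]) simp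
  moreover have "(?g has_sum infsum (cubic_term a (j + k)) ?S) UNIV \<longleftrightarrow> (cubic_term a (j + k) has_sum infsum (cubic_term a (j + k)) ?S) ?S"
    by (rule has_sum_reindex_bij_witness[where j = "\<lambda>(m, l). (j + l + 1, m + k)" and i = "\<lambda>(p, r). (r - k, p - j - 1)"])
       (auto simp: cubic_term_def mult_ac add_ac)
  ultimately have g: "(?g has_sum infsum (cubic_term a (j + k)) ?S) (UNIV \<times> UNIV)" by simp
  have "mat_apply (hankel_square a) (\<lambda>m. a (m + k)) j = (\<Sum>\<^sub>\<infinity>m. \<Sum>\<^sub>\<infinity>l. ?g (m, l))"
    unfolding mat_apply_def hankel_square_def mat_mult_def infsum_cmult_left'[symmetric] by (simp add: conj_mat_def hankel_def)
  also have "\<dots> = infsum ?g (UNIV \<times> UNIV)"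
    using infsum_Sigma'_banach[of "\<lambda>m l. ?g (m, l)" UNIV "\<lambda>_. UNIV"] g
    by (auto simp: has_sum_imp_summable case_prod_unfold)
  also have "\<dots> = infsum (cubic_term a (j + k)) ?S" by (rule infsumI[OF g])
  finally show ?thesis .
qed

lemma infsum_cubic_term_Un:
  assumes a: "a abs_summable_on UNIV" and "A \<inter> B = {}"
  shows "infsum (cubic_term a n) (A \<union> B) = infsum (cubic_term a n) A + infsum (cubic_term a n) B"
  by (rule infsum_Un_disjoint)
     (use assms in \<open>auto intro: summable_on_subset_banach[OF abs_summable_summable[OF cubic_term_summable[OF a]]]\<close>)

lemma cubic_eq_mat_apply:
  assumes a: "a abs_summable_on UNIV"
  shows "cubic a j = mat_apply (toeplitz_square a) a j + mat_apply (hankel_square a) a j"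
proof -
  have U: "UNIV = {(p, r). p \<le> j \<and> 0 \<le> (r::nat)} \<union> {(p, r). j < p \<and> 0 \<le> r}" by auto
  show ?thesis
    using mat_apply_toeplitz_square_shift[OF a, of 0 j] mat_apply_hankel_square_shift[OF a, of 0 j]
    unfolding cubic_def by (subst U, subst infsum_cubic_term_Un[OF a]) auto
qed

text \<open>
  If \<open>p \<le> j\<close> and \<open>r \<le> k\<close> then \<open>p + r < j + k + 1\<close> and the term is absent. The remaining pairs split into
  \<open>p \<le> j, r > k\<close> and \<open>p > j, r \<le> k\<close> and \<open>p > j, r > k\<close>. The second set is the mirror image of the first, since the
  summand is symmetric in \<open>p\<close> and \<open>r\<close>.
\<close>

lemma cubic_eq_mat_mult:
  assumes a: "a abs_summable_on UNIV"
  shows "cubic a (j + k + 1) = mat_mult (toeplitz_square a) (hankel a) j k + mat_mult (toeplitz_square a) (hankel a) k j + mat_mult (hankel_square a) (hankel a) j k"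
proof -
  let ?n = "j + k + 1"
  have P: "mat_mult (toeplitz_square a) (hankel a) j k = infsum (cubic_term a (j + k + 1)) {(p, r). p \<le> j \<and> k + 1 \<le> r}" for j k
    using mat_apply_toeplitz_square_shift[OF a, of "k + 1" j] by (simp add: mat_mult_def hankel_def)
  have Q: "mat_mult (hankel_square a) (hankel a) j k = infsum (cubic_term a ?n) {(p, r). j < p \<and> k + 1 \<le> r}"
    using mat_apply_hankel_square_shift[OF a, of "k + 1" j] by (simp add: mat_mult_def hankel_def)
  have "mat_mult (toeplitz_square a) (hankel a) k j = infsum (cubic_term a ?n) {(p, r). p \<le> k \<and> j + 1 \<le> r}"
    using P[of k j] by (simp add: add.commute)
  also have "\<dots> = infsum (cubic_term a ?n) {(p, r). r \<le> k \<and> j + 1 \<le> p}"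
    by (rule infsum_reindex_bij_witness[where j = prod.swap and i = prod.swap])
       (auto simp: cubic_term_def add.commute mult_ac)
  finally have P': "mat_mult (toeplitz_square a) (hankel a) k j = infsum (cubic_term a ?n) {(p, r). r \<le> k \<and> j + 1 \<le> p}" .
  have "cubic a ?n = infsum (cubic_term a ?n) (({(p, r). p \<le> j \<and> k + 1 \<le> r} \<union> {(p, r). r \<le> k \<and> j + 1 \<le> p})
      \<union> {(p, r). j < p \<and> k + 1 \<le> r})"
    unfolding cubic_def by (rule infsum_cong_neutral) (auto simp: cubic_term_def)
  also have "\<dots> = mat_mult (toeplitz_square a) (hankel a) j k + mat_mult (toeplitz_square a) (hankel a) k j + mat_mult (hankel_square a) (hankel a) j k"
    unfolding P' P[of j k] Q by (subst infsum_cubic_term_Un[OF a], force)+ simp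
  finally show ?thesis .
qed

lemma schur_row_bounded_summable:
  assumes "schur \<kappa> M" "\<And>n. cmod (x n) \<le> B"
  shows "(\<lambda>k. M j k * x k) summable_on UNIV"
  using cmult_bounded_abs_summable(1)[of "M j" x B] assms
  by (auto simp: schur_def intro: abs_summable_summable)

lemma mat_apply_add_mat:
  assumes "schur \<kappa> M" "schur \<kappa>' N" "\<And>n. cmod (x n) \<le> B"
  shows "mat_apply (\<lambda>j k. M j k + N j k) x j = mat_apply M x j + mat_apply N x j"
  unfolding mat_apply_def distrib_right
  by (intro infsum_add schur_row_bounded_summable[OF assms(1,3)] schur_row_bounded_summable[OF assms(2,3)])

lemma mat_apply_cmult_mat: "mat_apply (\<lambda>j k. c * M j k) x j = c * mat_apply M x j"
  unfolding mat_apply_def by (simp add: mult.assoc infsum_cmult_right')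

lemma abs_summable_mat_apply:
  assumes M: "schur \<kappa> M" and x: "x abs_summable_on UNIV"
  shows "mat_apply M x abs_summable_on UNIV"
proof -
  \<comment> \<open>Schur sums with weights \<open>(cmod (y k))\<^sup>2\<close> have been bounded above; this choice makes the weight \<open>cmod (x k)\<close>.\<close>
  define y where "y k = complex_of_real (sqrt (cmod (x k)))" for k
  have y: "ell2 y" using x by (simp add: ell2_def y_def)
  have "(\<lambda>j. \<Sum>\<^sub>\<infinity>k. cmod (M j k * x k)) summable_on UNIV"
    using schur_pairs(4)[OF M y] by (simp add: y_def norm_mult)
  then show ?thesis
  proof (rule Infinite_Sum.abs_summable_on_comparison_test')
    show "cmod (mat_apply M x j) \<le> (\<Sum>\<^sub>\<infinity>k. cmod (M j k * x k))" for j
      unfolding mat_apply_def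
      by (rule norm_infsum_bound, rule cmult_bounded_abs_summable(1)[OF _ abs_summable_bounded[OF x]])
         (use M in \<open>simp add: schur_def\<close>)
  qed
qed

lemma cubic_abs_summable:
  assumes a: "a abs_summable_on UNIV"
  shows "cubic a abs_summable_on UNIV"
proof -
  have "cubic a = mat_apply (\<lambda>j k. toeplitz_square a j k + hankel_square a j k) a"
    using mat_apply_add_mat[OF schur_toeplitz_square[OF a] schur_hankel_square[OF a] abs_summable_bounded[OF a]] cubic_eq_mat_apply[OF a] by auto
  then show ?thesis
    using abs_summable_mat_apply[OF schur_add[OF schur_toeplitz_square[OF a] schur_hankel_square[OF a]] a] by simp
qed

text \<open>
  The product \<open>Q G\<close> is symmetric, because everything else in \<open>cubic_eq_mat_mult\<close> is. Sharing it equally between the two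
  sides of \<open>G\<close> yields the form \<open>C G + (C G)\<^sup>T\<close>.
\<close>

lemma lax_pair:
  assumes a: "a abs_summable_on UNIV"
  obtains \<kappa> C where "schur \<kappa> C" "\<And>j k. C k j = - cnj (C j k)"
    "\<And>j k. - \<i> * cubic a (j + k + 1) = mat_mult C (hankel a) j k + mat_mult C (hankel a) k j"
proof -
  define C where "C j k = - \<i> * (toeplitz_square a j k + 1/2 * hankel_square a j k)" for j k
  define \<kappa> where "\<kappa> = cmod (- \<i>) * ((l1_norm a)\<^sup>2 + cmod (1/2) * (l1_norm a)\<^sup>2)"
  have sQ: "schur (cmod (1/2) * (l1_norm a)\<^sup>2) (\<lambda>j k. 1/2 * hankel_square a j k)"
    by (rule schur_cmult[OF schur_hankel_square[OF a]])
  have 1: "schur \<kappa> C"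
    unfolding C_def \<kappa>_def by (intro schur_cmult schur_add schur_toeplitz_square a sQ)
  have 2: "C k j = - cnj (C j k)" for j k
    unfolding C_def toeplitz_square_hermitian[of a k j] hankel_square_hermitian[of a k j] by (simp add: algebra_simps)
  have bd: "cmod (hankel a m k) \<le> l1_norm a" for m k
    unfolding hankel_def by (rule abs_summable_bounded[OF a])
  have mmC: "mat_mult C (hankel a) j k = - \<i> * (mat_mult (toeplitz_square a) (hankel a) j k + 1/2 * mat_mult (hankel_square a) (hankel a) j k)" for j k
    unfolding mat_mult_def C_def mat_apply_cmult_mat
    by (subst mat_apply_add_mat[OF schur_toeplitz_square[OF a] sQ bd]) (simp only: mat_apply_cmult_mat)
  have sym: "mat_mult (hankel_square a) (hankel a) j k = mat_mult (hankel_square a) (hankel a) k j" for j k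
  proof -
    have "cubic a (j + k + 1) = cubic a (k + j + 1)" by (simp add: add.commute)
    then show ?thesis unfolding cubic_eq_mat_mult[OF a] by simp
  qed
  have 3: "- \<i> * cubic a (j + k + 1) = mat_mult C (hankel a) j k + mat_mult C (hankel a) k j" for j k
    unfolding mmC cubic_eq_mat_mult[OF a] sym[of k j] by (simp add: algebra_simps)
  show thesis using that[OF 1 2 3] .
qed

text \<open>
  The vector equation for \<open>a\<close> itself. Here the perturbation does contribute, through the diagonal matrix
  with the single entry \<open>\<alpha>\<close>; it is Hermitian since \<open>\<alpha>\<close> is real.
\<close>

lemma mass_skew:
  assumes a: "a abs_summable_on UNIV"
  obtains \<kappa> C where "schur \<kappa> C" "\<And>j k. C k j = - cnj (C j k)"
    "\<And>j. - \<i> * (cubic a j + (if j = 0 then of_real \<alpha> * a 0 else 0)) = mat_apply C a j"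
proof -
  define E :: mat where "E = (\<lambda>j k. if j = 0 \<and> k = 0 then complex_of_real \<alpha> else 0 :: complex)"
  have sE: "schur \<bar>\<alpha>\<bar> E"
  proof -
    have *: "f abs_summable_on UNIV \<and> (\<Sum>\<^sub>\<infinity>k. cmod (f k)) \<le> \<bar>\<alpha>\<bar>"
      if f: "\<And>k. k \<noteq> 0 \<Longrightarrow> f k = 0" "cmod (f 0) \<le> \<bar>\<alpha>\<bar>" for f :: "nat \<Rightarrow> complex"
    proof -
      have "(\<lambda>k. cmod (f k)) summable_on UNIV \<longleftrightarrow> (\<lambda>k. cmod (f k)) summable_on {0}"
        by (rule summable_on_cong_neutral) (use f in auto)
      moreover have "(\<Sum>\<^sub>\<infinity>k. cmod (f k)) = (\<Sum>\<^sub>\<infinity>k\<in>{0}. cmod (f k))"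
        by (rule infsum_cong_neutral) (use f in auto)
      ultimately show ?thesis using f by simp
    qed
    show ?thesis unfolding schur_def
      by (intro conjI allI *[THEN conjunct1] *[THEN conjunct2]) (auto simp: E_def)
  qed
  define C where "C j k = - \<i> * (toeplitz_square a j k + hankel_square a j k + E j k)" for j k
  define \<kappa> where "\<kappa> = cmod (- \<i>) * ((l1_norm a)\<^sup>2 + (l1_norm a)\<^sup>2 + \<bar>\<alpha>\<bar>)"
  have 1: "schur \<kappa> C"
    unfolding C_def \<kappa>_def by (intro schur_cmult schur_add schur_toeplitz_square schur_hankel_square a sE)
  have 2: "C k j = - cnj (C j k)" for j k
    unfolding C_def toeplitz_square_hermitian[of a k j] hankel_square_hermitian[of a k j] by (simp add: E_def algebra_simps)
  have Ea: "mat_apply E a j = (if j = 0 then of_real \<alpha> * a 0 else 0)" for j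
  proof -
    have "mat_apply E a j = (\<Sum>\<^sub>\<infinity>k\<in>{0}. E j k * a k)"
      unfolding mat_apply_def by (rule infsum_cong_neutral) (auto simp: E_def)
    then show ?thesis by (simp add: E_def)
  qed
  note bd = abs_summable_bounded[OF a]
  have 3: "- \<i> * (cubic a j + (if j = 0 then of_real \<alpha> * a 0 else 0)) = mat_apply C a j" for j
    unfolding C_def mat_apply_cmult_mat cubic_eq_mat_apply[OF a] Ea[symmetric]
      mat_apply_add_mat[OF schur_add[OF schur_toeplitz_square[OF a] schur_hankel_square[OF a]] sE bd]
      mat_apply_add_mat[OF schur_toeplitz_square[OF a] schur_hankel_square[OF a] bd] ..
  show thesis using that[OF 1 2 3] .
qed

section \<open>The trace norm of a Hankel matrix\<close>

text \<open>
  Bessel's inequality with constant \<open>B\<close>. Orthonormal systems satisfy it with \<open>B = 1\<close>, but in contrast to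
  orthonormality it survives, with an explicit constant, the application of bounded matrices.
\<close>

definition bessel :: "real \<Rightarrow> nat \<Rightarrow> (nat \<Rightarrow> nat \<Rightarrow> complex) \<Rightarrow> bool" where
  "bessel B m f \<longleftrightarrow> (\<forall>k<m. ell2 (f k)) \<and>
     (\<forall>x. ell2 x \<longrightarrow> (\<Sum>k<m. (cmod (dot (f k) x))\<^sup>2) \<le> B * (l2_norm x)\<^sup>2)"

lemma bessel_cmult:
  assumes "bessel B m f"
  shows "bessel ((cmod c)\<^sup>2 * B) m (\<lambda>k n. c * f k n)"
  using assms unfolding bessel_def
  by (auto simp: dot_cmult norm_mult power_mult_distrib ell2_cmult mult.assoc mult_left_mono
           simp flip: sum_distrib_left)

lemma bessel_mono: "bessel B m f \<Longrightarrow> B \<le> B' \<Longrightarrow> bessel B' m f"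
  unfolding bessel_def by (meson mult_right_mono order_trans zero_le_power2)

lemma transp_transp: "transp (transp M) = M"
  by (intro ext) (simp add: transp_def)

lemma bessel_mat_apply:
  assumes f: "bessel 1 m f" and M: "schur \<kappa> M"
  shows "bessel (\<kappa>\<^sup>2) m (\<lambda>k. mat_apply M (f k))"
  unfolding bessel_def
proof (intro conjI allI impI)
  have fk: "ell2 (f k)" if "k < m" for k using f that by (simp add: bessel_def)
  show "ell2 (mat_apply M (f k))" if "k < m" for k using schur_mat_apply(1)[OF M fk[OF that]] .
  fix x assume x: "ell2 x"
  have T: "schur \<kappa> (transp M)" using M by (rule schur_transp)
  have "dot (mat_apply M (f k)) x = dot (f k) (mat_apply (transp M) x)" if "k < m" for k
    using dot_mat_apply[OF T fk[OF that] x] by (simp only: transp_transp)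
  then have "(\<Sum>k<m. (cmod (dot (mat_apply M (f k)) x))\<^sup>2) = (\<Sum>k<m. (cmod (dot (f k) (mat_apply (transp M) x)))\<^sup>2)"
    by (intro sum.cong) auto
  also have "\<dots> \<le> 1 * (l2_norm (mat_apply (transp M) x))\<^sup>2"
    using f schur_mat_apply(1)[OF T x] unfolding bessel_def by blast
  also have "\<dots> \<le> (\<kappa> * l2_norm x)\<^sup>2"
    using schur_mat_apply(2)[OF T x] by (simp add: power_mono)
  finally show "(\<Sum>k<m. (cmod (dot (mat_apply M (f k)) x))\<^sup>2) \<le> \<kappa>\<^sup>2 * (l2_norm x)\<^sup>2"
    by (simp add: power_mult_distrib)
qed

text \<open>
  Moving the matrix to the test vector \<open>x\<close> turns the step on the system into \<open>x + h C x\<close>, whose norm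
  \<open>l2_norm_skew_step\<close> controls.
\<close>

lemma bessel_skew_step:
  assumes f: "bessel 1 m f" and C: "schur \<kappa> C" and skew: "\<And>j k. C k j = - cnj (C j k)"
  shows "bessel (1 + h\<^sup>2 * \<kappa>\<^sup>2) m (\<lambda>k n. f k n + of_real h * mat_apply (transp C) (f k) n)"
  unfolding bessel_def
proof (intro conjI allI impI)
  have fk: "ell2 (f k)" if "k < m" for k using f that by (simp add: bessel_def)
  have Ef: "ell2 (mat_apply (transp C) (f k))" if "k < m" for k using schur_mat_apply(1)[OF schur_transp[OF C] fk[OF that]] .
  show "ell2 (\<lambda>n. f k n + of_real h * mat_apply (transp C) (f k) n)" if "k < m" for k
    using that by (intro ell2_add ell2_cmult Ef fk)
  fix x assume x: "ell2 x"
  have Cx: "ell2 (mat_apply C x)" using schur_mat_apply(1)[OF C x] .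
  let ?y = "\<lambda>n. x n + of_real h * mat_apply C x n"
  have y: "ell2 ?y" by (intro ell2_add ell2_cmult x Cx)
  have eq: "dot (\<lambda>n. f k n + of_real h * mat_apply (transp C) (f k) n) x = dot (f k) ?y" if "k < m" for k
    using dot_mat_apply[OF C fk[OF that] x]
    by (simp add: dot_add[OF x fk[OF that] ell2_cmult[OF Ef[OF that]]]
          dot_add[OF fk[OF that] x ell2_cmult[OF Cx]] dot_cmult)
  have "(\<Sum>k<m. (cmod (dot (\<lambda>n. f k n + of_real h * mat_apply (transp C) (f k) n) x))\<^sup>2)
      = (\<Sum>k<m. (cmod (dot (f k) ?y))\<^sup>2)"
    by (intro sum.cong) (auto simp: eq)
  also have "\<dots> \<le> 1 * (l2_norm ?y)\<^sup>2"
    using f y unfolding bessel_def by blast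
  also have "\<dots> \<le> (1 + h\<^sup>2 * \<kappa>\<^sup>2) * (l2_norm x)\<^sup>2"
    using l2_norm_skew_step[OF C skew x] by simp
  finally show "(\<Sum>k<m. (cmod (dot (\<lambda>n. f k n + of_real h * mat_apply (transp C) (f k) n) x))\<^sup>2)
      \<le> (1 + h\<^sup>2 * \<kappa>\<^sup>2) * (l2_norm x)\<^sup>2" .
qed

lemma dot_single:
  "dot (\<lambda>n. if n = i then c else 0) x = c * x i"
proof -
  have "dot (\<lambda>n. if n = i then c else 0) x = (\<Sum>\<^sub>\<infinity>n\<in>{i}. c * x n)"
    unfolding dot_def by (rule infsum_cong_neutral) auto
  then show ?thesis by simp
qed

lemma ell2_single: "ell2 (\<lambda>n. if n = i then c else 0)" "l2_norm (\<lambda>n. if n = i then c else 0) = cmod c"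
proof -
  have "(\<lambda>n. (cmod (if n = i then c else 0))\<^sup>2) summable_on UNIV \<longleftrightarrow> (\<lambda>n. (cmod c)\<^sup>2) summable_on {i}"
    by (rule summable_on_cong_neutral) auto
  then show "ell2 (\<lambda>n. if n = i then c else 0)" by (simp add: ell2_def)
  have "(\<Sum>\<^sub>\<infinity>n. (cmod (if n = i then c else 0))\<^sup>2) = (\<Sum>\<^sub>\<infinity>n\<in>{i}. (cmod c)\<^sup>2)"
    by (rule infsum_cong_neutral) auto
  then show "l2_norm (\<lambda>n. if n = i then c else 0) = cmod c" by (simp add: l2_norm_def)
qed

lemma bessel_coordinates:
  assumes c: "\<And>k. cmod (c k) \<le> 1"
  shows "bessel 1 m (\<lambda>k n. if n = k + q then c k else 0)"
  unfolding bessel_def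
proof (intro conjI allI impI ell2_single)
  fix x assume x: "ell2 x"
  have "(\<Sum>k<m. (cmod (dot (\<lambda>n. if n = k + q then c k else 0) x))\<^sup>2) \<le> (\<Sum>k<m. (cmod (x (k + q)))\<^sup>2)"
    unfolding dot_single norm_mult using c
    by (intro sum_mono power_mono) (auto simp: mult_left_le_one_le)
  also have "\<dots> = (\<Sum>i\<in>(\<lambda>k. k + q) ` {..<m}. (cmod (x i))\<^sup>2)"
    by (subst sum.reindex) auto
  also have "\<dots> \<le> (\<Sum>\<^sub>\<infinity>i. (cmod (x i))\<^sup>2)"
    using x by (intro finite_sum_le_infsum) (auto simp: ell2_def)
  finally show "(\<Sum>k<m. (cmod (dot (\<lambda>n. if n = k + q then c k else 0) x))\<^sup>2) \<le> 1 * (l2_norm x)\<^sup>2"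
    by (simp add: l2_norm_power2)
qed

definition pairing :: "(nat \<Rightarrow> complex) \<Rightarrow> nat \<Rightarrow> (nat \<Rightarrow> nat \<Rightarrow> complex) \<Rightarrow> (nat \<Rightarrow> nat \<Rightarrow> complex) \<Rightarrow> complex" where
  "pairing a m f g = (\<Sum>k<m. dot (f k) (mat_apply (hankel a) (g k)))"

text \<open>
  The nuclear norm of \<open>hankel a\<close>, written as a supremum of functionals that are linear in \<open>a\<close>.
\<close>

definition trace_norm :: "(nat \<Rightarrow> complex) \<Rightarrow> real" where
  "trace_norm a = Sup {cmod (pairing a m f g) | m f g. bessel 1 m f \<and> bessel 1 m g}"

definition row_norm_sum :: "(nat \<Rightarrow> complex) \<Rightarrow> real" where
  "row_norm_sum a = (\<Sum>\<^sub>\<infinity>i. l2_norm (hankel a i))"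

text \<open>
  The sequences for which the supremum defining the trace norm is finite for the obvious reason that
  the norms of the rows are summable.
\<close>

definition regular :: "(nat \<Rightarrow> complex) \<Rightarrow> bool" where
  "regular a \<longleftrightarrow> a abs_summable_on UNIV \<and> (\<forall>i. ell2 (hankel a i)) \<and> (\<lambda>i. l2_norm (hankel a i)) summable_on UNIV"

lemma has_sum_sum_lessThan:
  fixes F :: "nat \<Rightarrow> 'a \<Rightarrow> complex"
  assumes "\<And>k. k < m \<Longrightarrow> (F k has_sum s k) A"
  shows "((\<lambda>i. \<Sum>k<m. F k i) has_sum (\<Sum>k<m. s k)) A"
  using assms by (induction m) (auto intro: has_sum_add)

text \<open>
  For every row \<open>i\<close>, Bessel's inequality tested on the \<open>i\<close>-th unit vector bounds the system \<open>f\<close>, and tested on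
  the row itself it bounds the system \<open>g\<close>; the Cauchy-Schwarz inequality over \<open>k\<close> combines the two.
\<close>

lemma pairing_le_row_norm_sum:
  assumes a: "regular a" and f: "bessel 1 m f" and g: "bessel 1 m g"
  shows "cmod (pairing a m f g) \<le> row_norm_sum a"
proof -
  have ra: "ell2 (hankel a i)" "(\<lambda>i. l2_norm (hankel a i)) summable_on UNIV" for i
    using a by (auto simp: regular_def)
  have S: "schur (l1_norm a) (hankel a)" using a by (simp add: schur_hankel regular_def)
  have fk: "ell2 (f k)" "ell2 (g k)" if "k < m" for k using f g that by (auto simp: bessel_def)
  define w where "w i = (\<Sum>k<m. f k i * mat_apply (hankel a) (g k) i)" for i
  have s: "(\<lambda>i. f k i * mat_apply (hankel a) (g k) i) abs_summable_on UNIV" if "k < m" for k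
    by (rule cauchy_schwarz_ell2(1)[OF fk(1)[OF that] schur_mat_apply(1)[OF S fk(2)[OF that]]])
  have "(w has_sum pairing a m f g) UNIV"
    unfolding w_def pairing_def dot_def
    by (intro has_sum_sum_lessThan has_sum_infsum) (rule abs_summable_summable[OF s])
  then have eq: "pairing a m f g = infsum w UNIV" by (simp add: infsumI)
  have le: "cmod (w i) \<le> l2_norm (hankel a i)" for i
  proof -
    have e: "ell2 (\<lambda>n. if n = i then 1 else 0)" by (rule ell2_single)
    have "(\<Sum>k<m. (cmod (f k i))\<^sup>2) \<le> 1"
    proof -
      have "(\<Sum>k<m. (cmod (dot (f k) (\<lambda>n. if n = i then 1 else 0)))\<^sup>2) \<le> 1 * (l2_norm (\<lambda>n. if n = i then 1 else 0))\<^sup>2"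
        using f e unfolding bessel_def by blast
      then show ?thesis by (simp add: dot_commute[of "f _"] dot_single ell2_single)
    qed
    then have 1: "L2_set (\<lambda>k. cmod (f k i)) {..<m} \<le> 1" by (simp add: L2_set_def)
    have "(\<Sum>k<m. (cmod (dot (g k) (hankel a i)))\<^sup>2) \<le> 1 * (l2_norm (hankel a i))\<^sup>2"
      using g ra(1)[of i] unfolding bessel_def by blast
    moreover have "mat_apply (hankel a) (g k) i = dot (g k) (hankel a i)" for k
      by (simp add: mat_apply_def dot_def mult.commute)
    ultimately have 2: "L2_set (\<lambda>k. cmod (mat_apply (hankel a) (g k) i)) {..<m} \<le> l2_norm (hankel a i)"
      by (simp add: L2_set_def real_le_lsqrt)
    have "cmod (w i) \<le> (\<Sum>k<m. \<bar>cmod (f k i)\<bar> * \<bar>cmod (mat_apply (hankel a) (g k) i)\<bar>)"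
      unfolding w_def by (rule order_trans[OF norm_sum]) (simp add: norm_mult)
    also have "\<dots> \<le> L2_set (\<lambda>k. cmod (f k i)) {..<m} * L2_set (\<lambda>k. cmod (mat_apply (hankel a) (g k) i)) {..<m}"
      by (rule L2_set_mult_ineq)
    also have "\<dots> \<le> 1 * l2_norm (hankel a i)" using 1 2 by (intro mult_mono) auto
    finally show ?thesis by simp
  qed
  have ws: "w abs_summable_on UNIV"
    by (rule Infinite_Sum.abs_summable_on_comparison_test'[OF ra(2) le])
  have "cmod (infsum w UNIV) \<le> (\<Sum>\<^sub>\<infinity>i. cmod (w i))" by (rule norm_infsum_bound[OF ws])
  also have "\<dots> \<le> row_norm_sum a" unfolding row_norm_sum_def using ws ra(2) le by (rule infsum_mono)
  finally show ?thesis by (simp add: eq)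
qed

lemma bessel_zero: "bessel 1 0 f" by (simp add: bessel_def)

lemma pairing_le_trace_norm:
  assumes a: "regular a" and "bessel 1 m f" "bessel 1 m g"
  shows "cmod (pairing a m f g) \<le> trace_norm a"
  unfolding trace_norm_def
  by (rule cSup_upper) (use assms pairing_le_row_norm_sum in \<open>auto intro!: bdd_aboveI[where M="row_norm_sum a"]\<close>)

lemma trace_norm_leI:
  assumes "\<And>m f g. bessel 1 m f \<Longrightarrow> bessel 1 m g \<Longrightarrow> cmod (pairing a m f g) \<le> B"
  shows "trace_norm a \<le> B"
  unfolding trace_norm_def
proof (rule cSup_least)
  show "{cmod (pairing a m f g) |m f g. bessel 1 m f \<and> bessel 1 m g} \<noteq> {}"
    using bessel_zero by blast
qed (use assms in blast)

lemma trace_norm_le_row_norm_sum: "regular a \<Longrightarrow> trace_norm a \<le> row_norm_sum a"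
  by (rule trace_norm_leI) (rule pairing_le_row_norm_sum)

lemma pairing_cmult: "pairing a m (\<lambda>k n. c * f k n) (\<lambda>k n. d * g k n) = c * d * pairing a m f g"
proof -
  have "mat_apply (hankel a) (\<lambda>n. d * x n) = (\<lambda>i. d * mat_apply (hankel a) x i)" for x
    unfolding mat_apply_def infsum_cmult_right'[symmetric] by (simp add: mult.left_commute)
  then show ?thesis by (simp add: pairing_def dot_cmult sum_distrib_left mult_ac)
qed

lemma pairing_le_bessel:
  assumes a: "regular a" and B: "B > 0" and f: "bessel B m f" and g: "bessel B m g"
  shows "cmod (pairing a m f g) \<le> B * trace_norm a"
proof -
  define c where "c = complex_of_real (1 / sqrt B)"
  have cc: "(cmod c)\<^sup>2 * B = 1" using B by (simp add: c_def norm_divide power_divide)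
  have "cmod (pairing a m (\<lambda>k n. c * f k n) (\<lambda>k n. c * g k n)) \<le> trace_norm a"
    using bessel_cmult[OF f, of c] bessel_cmult[OF g, of c] by (intro pairing_le_trace_norm a) (simp_all add: cc)
  then have "(cmod c)\<^sup>2 * cmod (pairing a m f g) \<le> trace_norm a"
    by (simp add: pairing_cmult norm_mult power2_eq_square)
  then have "B * ((cmod c)\<^sup>2 * cmod (pairing a m f g)) \<le> B * trace_norm a"
    using B by (intro mult_left_mono) auto
  moreover have "B * ((cmod c)\<^sup>2 * cmod (pairing a m f g)) = (cmod c)\<^sup>2 * B * cmod (pairing a m f g)"
    by simp
  ultimately show ?thesis by (simp only: cc)
qed

lemma mat_apply_hankel_lincomb:
  assumes "a abs_summable_on UNIV" "d abs_summable_on UNIV" "ell2 x"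
  shows "mat_apply (hankel (\<lambda>n. a n + c * d n)) x i = mat_apply (hankel a) x i + c * mat_apply (hankel d) x i"
proof -
  have "hankel (\<lambda>n. a n + c * d n) = (\<lambda>j k. hankel a j k + c * hankel d j k)"
    by (intro ext) (simp add: hankel_def)
  then show ?thesis
    using mat_apply_add_mat[OF schur_hankel[OF assms(1)] schur_cmult[OF schur_hankel[OF assms(2)]] norm_le_l2_norm[OF assms(3)]]
    by (simp add: mat_apply_cmult_mat)
qed

lemma pairing_lincomb:
  assumes a: "a abs_summable_on UNIV" and d: "d abs_summable_on UNIV" and f: "bessel B m f" and g: "bessel B' m g"
  shows "pairing (\<lambda>n. a n + c * d n) m f g = pairing a m f g + c * pairing d m f g"
proof -
  have fk: "ell2 (f k)" "ell2 (g k)" if "k < m" for k using f g that by (auto simp: bessel_def)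
  have "dot (f k) (mat_apply (hankel (\<lambda>n. a n + c * d n)) (g k)) = dot (f k) (mat_apply (hankel a) (g k)) + c * dot (f k) (mat_apply (hankel d) (g k))"
    if "k < m" for k
  proof -
    have e: "ell2 (mat_apply (hankel a) (g k))" "ell2 (mat_apply (hankel d) (g k))"
      using schur_mat_apply(1)[OF schur_hankel[OF a] fk(2)[OF that]] schur_mat_apply(1)[OF schur_hankel[OF d] fk(2)[OF that]] .
    show ?thesis
      unfolding mat_apply_hankel_lincomb[OF a d fk(2)[OF that]] dot_add(1)[OF fk(1)[OF that] e(1) ell2_cmult[OF e(2)]]
      by (simp add: dot_cmult)
  qed
  then show ?thesis by (simp add: pairing_def sum.distrib sum_distrib_left)
qed

lemma trace_norm_triangle:
  assumes "regular a" "regular d"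
  shows "trace_norm (\<lambda>n. a n + c * d n) \<le> trace_norm a + cmod c * trace_norm d"
proof (rule trace_norm_leI)
  fix m f g assume fg: "bessel 1 m f" "bessel 1 m g"
  have "cmod (pairing (\<lambda>n. a n + c * d n) m f g) \<le> cmod (pairing a m f g) + cmod c * cmod (pairing d m f g)"
    using assms pairing_lincomb[OF _ _ fg, of a d c] norm_triangle_ineq[of "pairing a m f g" "c * pairing d m f g"]
    by (simp add: regular_def norm_mult)
  also have "\<dots> \<le> trace_norm a + cmod c * trace_norm d"
    using assms fg by (intro add_mono mult_left_mono pairing_le_trace_norm) auto
  finally show "cmod (pairing (\<lambda>n. a n + c * d n) m f g) \<le> trace_norm a + cmod c * trace_norm d" .
qed

text \<open>
  By the Lax equation, pairing \<open>G + h G'\<close> with \<open>f, g\<close> is pairing \<open>G\<close> with \<open>f + h C\<^sup>T f\<close> and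
  \<open>g + h C\<^sup>T g\<close>, up to \<open>h\<^sup>2\<close> times the pairing of \<open>G\<close> with \<open>C\<^sup>T f\<close> and \<open>C\<^sup>T g\<close>. All these systems
  satisfy Bessel's inequality, the first two with a constant \<open>1 + O(h\<^sup>2)\<close>.
\<close>

lemma trace_norm_lax_step:
  assumes a: "regular a" and d: "d abs_summable_on UNIV"
    and C: "schur \<kappa> C" and skew: "\<And>j k. C k j = - cnj (C j k)"
    and lax: "\<And>j k. d (j + k + 1) = mat_mult C (hankel a) j k + mat_mult C (hankel a) k j"
  shows "trace_norm (\<lambda>n. a n + of_real h * d n) \<le> trace_norm a + (2 * \<kappa>\<^sup>2 + 1) * trace_norm a * h\<^sup>2"
proof (rule trace_norm_leI)
  fix m f g assume f: "bessel 1 m f" and g: "bessel 1 m g"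
  have a1: "a abs_summable_on UNIV" using a by (simp add: regular_def)
  have G: "schur (l1_norm a) (hankel a)" by (rule schur_hankel[OF a1])
  have T: "schur \<kappa> (transp C)" using C by (rule schur_transp)
  let ?E = "mat_apply (transp C)" and ?G = "mat_apply (hankel a)" and ?h = "complex_of_real h"
  let ?F = "\<lambda>f k n. f k n + ?h * ?E (f k) n" and ?EE = "\<lambda>f k. ?E (f k)"
  have fg: "ell2 (f k)" "ell2 (g k)" if "k < m" for k using f g that by (auto simp: bessel_def)
  have dk: "dot x (mat_apply (hankel d) y) = dot (?E x) (?G y) + dot x (?G (?E y))"
    if x: "ell2 x" and y: "ell2 y" for x y
  proof -
    have M: "schur (\<kappa> * l1_norm a) (mat_mult C (hankel a))" by (rule schur_mat_mult[OF C G])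
    have hd: "hankel d = (\<lambda>j k. mat_mult C (hankel a) j k + transp (mat_mult C (hankel a)) j k)"
      by (intro ext) (simp only: hankel_def lax transp_def)
    have e: "ell2 (mat_apply C (?G y))" "ell2 (?G (?E y))"
      using schur_mat_apply(1)[OF C schur_mat_apply(1)[OF G y]] schur_mat_apply(1)[OF G schur_mat_apply(1)[OF T y]] .
    have "mat_apply (hankel d) y = (\<lambda>j. mat_apply (mat_mult C (hankel a)) y j + mat_apply (transp (mat_mult C (hankel a))) y j)"
      unfolding hd using mat_apply_add_mat[OF M schur_transp[OF M] norm_le_l2_norm[OF y]] by auto
    also have "\<dots> = (\<lambda>j. mat_apply C (?G y) j + ?G (?E y) j)"
      unfolding transp_mat_mult transp_hankel mat_apply_mat_mult[OF C G y] mat_apply_mat_mult[OF G T y] ..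
    finally have "dot x (mat_apply (hankel d) y) = dot x (mat_apply C (?G y)) + dot x (?G (?E y))"
      using dot_add(1)[OF x e] by simp
    then show ?thesis by (simp only: dot_mat_apply[OF C x schur_mat_apply(1)[OF G y]])
  qed
  have expand: "dot (?F f k) (?G (?F g k)) = dot (f k) (?G (g k)) + ?h * dot (f k) (mat_apply (hankel d) (g k))
      + ?h * ?h * dot (?E (f k)) (?G (?E (g k)))" if k: "k < m" for k
  proof -
    have e: "ell2 (?E (f k))" "ell2 (?E (g k))"
      using schur_mat_apply(1)[OF T fg(1)[OF k]] schur_mat_apply(1)[OF T fg(2)[OF k]] .
    have e2: "ell2 (?G (g k))" "ell2 (?G (?E (g k)))"
      using schur_mat_apply(1)[OF G fg(2)[OF k]] schur_mat_apply(1)[OF G e(2)] .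
    have lin: "?G (?F g k) = (\<lambda>i. ?G (g k) i + ?h * ?G (?E (g k)) i)"
    proof
      fix i
      have row: "(\<lambda>n. hankel a i n * x n) summable_on UNIV" if "ell2 x" for x
        by (rule schur_row_bounded_summable[OF G norm_le_l2_norm[OF that]])
      have "?G (?F g k) i = (\<Sum>\<^sub>\<infinity>n. hankel a i n * g k n + hankel a i n * (?h * ?E (g k) n))"
        unfolding mat_apply_def[of "hankel a"] by (simp only: distrib_left)
      also have "\<dots> = ?G (g k) i + (\<Sum>\<^sub>\<infinity>n. hankel a i n * (?h * ?E (g k) n))"
        unfolding mat_apply_def[of "hankel a"] by (intro infsum_add row fg(2) k ell2_cmult e)
      also have "(\<Sum>\<^sub>\<infinity>n. hankel a i n * (?h * ?E (g k) n)) = ?h * ?G (?E (g k)) i"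
        unfolding mat_apply_def[of "hankel a"] infsum_cmult_right'[symmetric] by (simp only: mult.left_commute)
      finally show "?G (?F g k) i = ?G (g k) i + ?h * ?G (?E (g k)) i" .
    qed
    show ?thesis
      unfolding lin dk[OF fg(1)[OF k] fg(2)[OF k]]
        dot_add(1)[OF ell2_add(1)[OF fg(1)[OF k] ell2_cmult[OF e(1)]] e2(1) ell2_cmult[OF e2(2)]]
        dot_add(2)[OF e2(1) fg(1)[OF k] ell2_cmult[OF e(1)]]
        dot_cmult dot_add(2)[OF e2(2) fg(1)[OF k] ell2_cmult[OF e(1)]]
      by (simp add: algebra_simps)
  qed
  have eq: "pairing (\<lambda>n. a n + ?h * d n) m f g = pairing a m (?F f) (?F g) - ?h * ?h * pairing a m (?EE f) (?EE g)"
    unfolding pairing_lincomb[OF a1 d f g] unfolding pairing_def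
    by (simp add: expand sum.distrib sum_distrib_left)
  have 1: "cmod (pairing a m (?F f) (?F g)) \<le> (1 + h\<^sup>2 * \<kappa>\<^sup>2) * trace_norm a"
    by (intro pairing_le_bessel a bessel_skew_step f g C skew add_pos_nonneg) auto
  \<comment> \<open>Rescaling to constant \<open>1\<close> needs a positive Bessel constant; \<open>\<kappa>\<close> may be zero, hence \<open>\<kappa>\<^sup>2 + 1\<close>.\<close>
  have 2: "cmod (pairing a m (?EE f) (?EE g)) \<le> (\<kappa>\<^sup>2 + 1) * trace_norm a"
    by (intro pairing_le_bessel a bessel_mono[OF bessel_mat_apply[OF f T]] bessel_mono[OF bessel_mat_apply[OF g T]] add_nonneg_pos) auto
  have "cmod (pairing (\<lambda>n. a n + ?h * d n) m f g) \<le> cmod (pairing a m (?F f) (?F g)) + cmod (?h * ?h * pairing a m (?EE f) (?EE g))"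
    unfolding eq by (rule norm_triangle_ineq4)
  also have "cmod (?h * ?h * pairing a m (?EE f) (?EE g)) = h\<^sup>2 * cmod (pairing a m (?EE f) (?EE g))"
    by (simp add: norm_mult power2_eq_square)
  also have "cmod (pairing a m (?F f) (?F g)) + h\<^sup>2 * cmod (pairing a m (?EE f) (?EE g))
      \<le> (1 + h\<^sup>2 * \<kappa>\<^sup>2) * trace_norm a + h\<^sup>2 * ((\<kappa>\<^sup>2 + 1) * trace_norm a)"
    using 1 2 by (intro add_mono mult_left_mono) auto
  finally show "cmod (pairing (\<lambda>n. a n + ?h * d n) m f g) \<le> trace_norm a + (2 * \<kappa>\<^sup>2 + 1) * trace_norm a * h\<^sup>2"
    by (simp add: algebra_simps)
qed

text \<open>
  The diagonal of the Hankel matrix holds the coefficients of odd index, the diagonal next to it those of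
  positive even index: these are the cases \<open>q = 0\<close> and \<open>q = 1\<close>. The unimodular factors in the system of coordinate vectors turn each
  entry into its modulus.
\<close>

lemma sum_odd_even_le_trace_norm:
  assumes a: "regular a"
  shows "(\<Sum>k<m. cmod (a (2 * k + 1 + q))) \<le> trace_norm a"
proof -
  define c where "c k = cnj (sgn (a (2 * k + 1 + q)))" for k
  let ?f = "\<lambda>k n. if n = k + 0 then c k else 0"
  let ?g = "\<lambda>k n. if n = k + q then 1 else (0::complex)"
  have f: "bessel 1 m ?f" by (rule bessel_coordinates) (simp add: c_def norm_sgn)
  have g: "bessel 1 m ?g" by (rule bessel_coordinates) simp
  have "dot (?f k) (mat_apply (hankel a) (?g k)) = of_real (cmod (a (2 * k + 1 + q)))" for k
  proof -
    have "mat_apply (hankel a) (?g k) k = hankel a k (k + q)"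
      using dot_single[of "k + q" 1 "hankel a k"] by (simp add: mat_apply_def dot_def mult.commute)
    also have "\<dots> = a (2 * k + 1 + q)"
      by (simp add: hankel_def) (metis add.assoc mult_2)
    finally have "dot (?f k) (mat_apply (hankel a) (?g k)) = c k * a (2 * k + 1 + q)"
      unfolding dot_single by simp
    also have "\<dots> = of_real (cmod (a (2 * k + 1 + q)))"
    proof -
      have "cnj z * z = of_real (cmod z) * of_real (cmod z)" for z
        using complex_norm_square[of z] by (simp add: power2_eq_square mult.commute)
      then show ?thesis by (simp add: c_def sgn_eq)
    qed
    finally show ?thesis .
  qed
  then have "pairing a m ?f ?g = of_real (\<Sum>k<m. cmod (a (2 * k + 1 + q)))"
    by (simp add: pairing_def)
  then have "cmod (pairing a m ?f ?g) = (\<Sum>k<m. cmod (a (2 * k + 1 + q)))"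
    by (simp only: norm_of_real) (simp add: sum_nonneg)
  then show ?thesis using pairing_le_trace_norm[OF a f g] by simp
qed

lemma partial_wiener_le_trace_norm:
  assumes a: "regular a"
  shows "(\<Sum>n<N. cmod (a n)) \<le> cmod (a 0) + 2 * trace_norm a"
proof -
  have "(\<Sum>n<N. cmod (a n)) \<le> (\<Sum>n<2 * N + 1. cmod (a n))"
    by (rule sum_mono2) auto
  also have "\<dots> = cmod (a 0) + ((\<Sum>k<N. cmod (a (2 * k + 1 + 0))) + (\<Sum>k<N. cmod (a (2 * k + 1 + 1))))"
    by (induction N) auto
  also have "\<dots> \<le> cmod (a 0) + (trace_norm a + trace_norm a)"
    by (intro add_left_mono add_mono sum_odd_even_le_trace_norm a)
  finally show ?thesis by simp
qed

section \<open>Sequences with Sobolev weights\<close>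

text \<open>
  The Sobolev condition on the coefficients of nonnegative index.
\<close>

definition weighted :: "real \<Rightarrow> (nat \<Rightarrow> complex) \<Rightarrow> bool" where
  "weighted s a \<longleftrightarrow> (\<lambda>n. (1 + (real n)\<^sup>2) powr s * (cmod (a n))\<^sup>2) summable_on UNIV"

definition weighted_norm :: "real \<Rightarrow> (nat \<Rightarrow> complex) \<Rightarrow> real" where
  "weighted_norm s a = sqrt (\<Sum>\<^sub>\<infinity>n. (1 + (real n)\<^sup>2) powr s * (cmod (a n))\<^sup>2)"

lemma weighted_norm_nonneg: "0 \<le> weighted_norm s a"
  unfolding weighted_norm_def by (simp add: infsum_nonneg)

lemma sum_weighted_le_weighted_norm:
  assumes "weighted s a" "finite F"
  shows "(\<Sum>n\<in>F. (1 + (real n)\<^sup>2) powr s * (cmod (a n))\<^sup>2) \<le> (weighted_norm s a)\<^sup>2"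
proof -
  have "(\<Sum>n\<in>F. (1 + (real n)\<^sup>2) powr s * (cmod (a n))\<^sup>2) \<le> (\<Sum>\<^sub>\<infinity>n. (1 + (real n)\<^sup>2) powr s * (cmod (a n))\<^sup>2)"
    using assms by (intro finite_sum_le_infsum) (auto simp: weighted_def)
  then show ?thesis by (simp add: weighted_norm_def infsum_nonneg)
qed

lemma weighted_lincomb:
  assumes "weighted s a" "weighted s b"
  shows "weighted s (\<lambda>n. a n + c * b n)"
  unfolding weighted_def
proof (rule summable_on_comparison_test)
  show "(\<lambda>n. 2 * ((1 + (real n)\<^sup>2) powr s * (cmod (a n))\<^sup>2) + 2 * (cmod c)\<^sup>2 * ((1 + (real n)\<^sup>2) powr s * (cmod (b n))\<^sup>2)) summable_on UNIV"
    using assms unfolding weighted_def by (intro summable_on_add summable_on_cmult_right)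
  fix n
  have "(cmod (a n + c * b n))\<^sup>2 \<le> 2 * (cmod (a n))\<^sup>2 + 2 * (cmod (c * b n))\<^sup>2"
    by (rule cmod_add_square_le)
  then have "(1 + (real n)\<^sup>2) powr s * (cmod (a n + c * b n))\<^sup>2
     \<le> (1 + (real n)\<^sup>2) powr s * (2 * (cmod (a n))\<^sup>2 + 2 * (cmod (c * b n))\<^sup>2)"
    by (intro mult_left_mono) auto
  then show "(1 + (real n)\<^sup>2) powr s * (cmod (a n + c * b n))\<^sup>2
     \<le> 2 * ((1 + (real n)\<^sup>2) powr s * (cmod (a n))\<^sup>2) + 2 * (cmod c)\<^sup>2 * ((1 + (real n)\<^sup>2) powr s * (cmod (b n))\<^sup>2)"
    by (simp add: norm_mult power_mult_distrib algebra_simps)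
qed auto

lemma weighted_ell2:
  assumes s: "s \<ge> 0" and a: "weighted s a"
  shows "ell2 a" "l2_norm a \<le> weighted_norm s a"
proof -
  have "(\<Sum>n\<in>F. (cmod (a n))\<^sup>2) \<le> (weighted_norm s a)\<^sup>2" if "finite F" for F
  proof -
    have "(\<Sum>n\<in>F. 1 * (cmod (a n))\<^sup>2) \<le> (\<Sum>n\<in>F. (1 + (real n)\<^sup>2) powr s * (cmod (a n))\<^sup>2)"
      using s by (intro sum_mono mult_right_mono ge_one_powr_ge_zero) auto
    then show ?thesis using sum_weighted_le_weighted_norm[OF a that] by simp
  qed
  from ell2I_finite_sums[OF this weighted_norm_nonneg] show "ell2 a" "l2_norm a \<le> weighted_norm s a" by auto
qed

text \<open>
  Row \<open>i\<close> contains the coefficients of index larger than \<open>i\<close> only, where the Sobolev weight is at least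
  \<open>(i + 1) powr (2 * s)\<close>.
\<close>

lemma hankel_row_decay:
  assumes s: "s > 0" and a: "weighted s a"
  shows "ell2 (hankel a i)" "l2_norm (hankel a i) \<le> real (Suc i) powr (- s) * weighted_norm s a"
proof -
  have sum: "(\<Sum>k\<in>F. (cmod (hankel a i k))\<^sup>2) \<le> (real (Suc i) powr (- s) * weighted_norm s a)\<^sup>2" if F: "finite F" for F
  proof -
    let ?w = "\<lambda>n. (1 + (real n)\<^sup>2) powr s" and ?c = "(real (Suc i) powr (- s))\<^sup>2"
    have w: "1 \<le> ?c * ?w n" if "n \<ge> Suc i" for n
    proof -
      have "(real (Suc i))\<^sup>2 \<le> 1 + (real n)\<^sup>2"
      proof -
        have "(real (Suc i))\<^sup>2 \<le> (real n)\<^sup>2" using that by (intro power_mono) auto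
        then show ?thesis by linarith
      qed
      then have "((real (Suc i))\<^sup>2) powr s \<le> ?w n" using s by (intro powr_mono2) auto
      moreover have "((real (Suc i))\<^sup>2) powr s = (real (Suc i) powr s)\<^sup>2"
        by (simp add: power2_eq_square powr_mult)
      ultimately have "?c * (real (Suc i) powr s)\<^sup>2 \<le> ?c * ?w n"
        by (intro mult_left_mono) auto
      moreover have "?c * (real (Suc i) powr s)\<^sup>2 = 1"
        by (simp add: power_mult_distrib[symmetric] powr_add[symmetric])
      ultimately show ?thesis by linarith
    qed
    have "(cmod (hankel a i k))\<^sup>2 \<le> ?c * (?w (i + k + 1) * (cmod (a (i + k + 1)))\<^sup>2)" for k
      using mult_right_mono[OF w[of "i + k + 1"], of "(cmod (a (i + k + 1)))\<^sup>2"]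
      by (simp add: hankel_def mult.assoc)
    then have "(\<Sum>k\<in>F. (cmod (hankel a i k))\<^sup>2) \<le> ?c * (\<Sum>k\<in>F. ?w (i + k + 1) * (cmod (a (i + k + 1)))\<^sup>2)"
      unfolding sum_distrib_left by (intro sum_mono)
    also have "(\<Sum>k\<in>F. ?w (i + k + 1) * (cmod (a (i + k + 1)))\<^sup>2) = (\<Sum>n\<in>(\<lambda>k. i + k + 1) ` F. ?w n * (cmod (a n))\<^sup>2)"
      by (subst sum.reindex) (auto simp: inj_on_def)
    also have "?c * \<dots> \<le> ?c * (weighted_norm s a)\<^sup>2"
      using F by (intro mult_left_mono sum_weighted_le_weighted_norm a) auto
    finally show ?thesis by (simp add: power_mult_distrib)
  qed
  have nn: "0 \<le> real (Suc i) powr (- s) * weighted_norm s a" by (simp add: weighted_norm_nonneg)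
  show "ell2 (hankel a i)" "l2_norm (hankel a i) \<le> real (Suc i) powr (- s) * weighted_norm s a"
    using ell2I_finite_sums[OF sum nn] by auto
qed

definition row_decay_sum :: "real \<Rightarrow> real" where
  "row_decay_sum s = (\<Sum>\<^sub>\<infinity>i. real (Suc i) powr (- s))"

lemma row_decay_sum_summable: "s > 1 \<Longrightarrow> (\<lambda>i. real (Suc i) powr (- s)) summable_on UNIV"
proof (rule summable_nonneg_imp_summable_on)
  assume "s > 1"
  then have "summable (\<lambda>n. real n powr (- s))" by (simp add: summable_real_powr_iff)
  then show "summable (\<lambda>i. real (Suc i) powr (- s))" by (subst summable_Suc_iff)
qed simp

lemma row_decay_sum_nonneg: "0 \<le> row_decay_sum s"
  unfolding row_decay_sum_def by (simp add: infsum_nonneg)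

text \<open>
  Here \<open>s > 1\<close> is essential: it makes the bounds for the norms of the rows summable.
\<close>

lemma weighted_regular:
  assumes s: "s > 1" and a: "weighted s a"
  shows "regular a" "row_norm_sum a \<le> row_decay_sum s * weighted_norm s a"
proof -
  have row: "ell2 (hankel a i)" "l2_norm (hankel a i) \<le> real (Suc i) powr (- s) * weighted_norm s a" for i
    using hankel_row_decay[of s a i] s a by auto
  have z: "(\<lambda>i. real (Suc i) powr (- s) * weighted_norm s a) summable_on UNIV"
    using row_decay_sum_summable[OF s] by (rule summable_on_cmult_left)
  have rs: "(\<lambda>i. l2_norm (hankel a i)) summable_on UNIV"
    by (rule summable_on_comparison_test[OF z row(2)]) simp
  have "(\<lambda>i. a (Suc i)) abs_summable_on UNIV"
  proof (rule Infinite_Sum.abs_summable_on_comparison_test'[OF rs])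
    show "cmod (a (Suc i)) \<le> l2_norm (hankel a i)" for i
      using norm_le_l2_norm[OF row(1), of i 0] by (simp add: hankel_def)
  qed
  then have "summable (\<lambda>i. cmod (a (Suc i)))" by (rule summable_on_imp_summable)
  then have "summable (\<lambda>i. cmod (a i))" by (subst (asm) summable_Suc_iff)
  then have "a abs_summable_on UNIV" by (rule summable_nonneg_imp_summable_on) simp
  then show "regular a" using row(1) rs by (simp add: regular_def)
  have "row_norm_sum a \<le> (\<Sum>\<^sub>\<infinity>i. real (Suc i) powr (- s) * weighted_norm s a)"
    unfolding row_norm_sum_def by (rule infsum_mono[OF rs z row(2)])
  then show "row_norm_sum a \<le> row_decay_sum s * weighted_norm s a" by (simp add: row_decay_sum_def infsum_cmult_left')
qed

section \<open>Conservation laws from one-sided difference quotients\<close>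

text \<open>
  Consider the last time at which the bound holds. If it comes before \<open>b\<close>, the local bound extends it.
\<close>

lemma dini_increment_le:
  fixes g :: "real \<Rightarrow> real"
  assumes cont: "continuous_on {a..b} g" and ab: "a < b" and e: "e > 0"
    and step: "\<And>t. a \<le> t \<Longrightarrow> t < b \<Longrightarrow> \<exists>d>0. \<forall>h. 0 < h \<and> h < d \<longrightarrow> g (t + h) \<le> g t + e * h"
  shows "g b \<le> g a + e * (b - a)"
proof -
  define f where "f t = g t - e * (t - a)" for t
  define T where "T = {t \<in> {a..b}. f t \<le> f a}"
  have fc: "continuous_on {a..b} f" unfolding f_def by (intro continuous_intros cont)
  have "closed T" unfolding T_def
    by (rule continuous_on_closed_Collect_le[OF fc continuous_on_const]) simp
  moreover have "T \<subseteq> {a..b}" by (auto simp: T_def)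
  ultimately have "compact T" by (metis bounded_closed_interval bounded_subset compact_eq_bounded_closed)
  moreover have "a \<in> T" using ab by (simp add: T_def)
  ultimately obtain c where c: "c \<in> T" "\<And>t. t \<in> T \<Longrightarrow> t \<le> c"
    using compact_attains_sup[of T] by blast
  have "c = b"
  proof (rule ccontr)
    assume "c \<noteq> b"
    then have cb: "a \<le> c" "c < b" using c(1) by (auto simp: T_def)
    obtain d where d: "d > 0" "\<And>h. 0 < h \<Longrightarrow> h < d \<Longrightarrow> g (c + h) \<le> g c + e * h"
      using step[OF cb] by blast
    define h where "h = min (d / 2) (b - c)"
    have h: "0 < h" "h < d" "c + h \<le> b" using d cb by (auto simp: h_def)
    have "f (c + h) \<le> f c" using d(2)[OF h(1,2)] by (simp add: f_def algebra_simps)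
    also have "f c \<le> f a" using c(1) by (simp add: T_def)
    finally have "c + h \<in> T" using h cb by (simp add: T_def)
    then show False using c(2) h(1) by fastforce
  qed
  then show ?thesis using c(1) by (simp add: T_def f_def)
qed

lemma dini_nonincreasing:
  fixes g :: "real \<Rightarrow> real"
  assumes cont: "continuous_on UNIV g" and ab: "a \<le> b"
    and step: "\<And>t e. e > 0 \<Longrightarrow> \<exists>d>0. \<forall>h. 0 < h \<and> h < d \<longrightarrow> g (t + h) \<le> g t + e * h"
  shows "g b \<le> g a"
proof (cases "a = b")
  case False
  then have "a < b" using ab by simp
  have "g b \<le> g a + e" if "e > 0" for e
  proof -
    have "g b \<le> g a + e / (b - a) * (b - a)"
      using \<open>a < b\<close> that
      by (intro dini_increment_le step continuous_on_subset[OF cont]) auto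
    then show ?thesis using \<open>a < b\<close> by simp
  qed
  then show ?thesis by (rule field_le_epsilon)
qed simp

text \<open>
  The hypothesis on \<open>N\<close> along \<open>d\<close> is one-sided: it only says that \<open>N\<close> does not grow to first order. But it holds
  for both signs of \<open>h\<close>, so \<open>N\<close> is nonincreasing along the curve and along its time reversal.
\<close>

lemma seminorm_conserved:
  fixes N :: "(nat \<Rightarrow> complex) \<Rightarrow> real" and a :: "real \<Rightarrow> nat \<Rightarrow> complex"
  assumes tri: "\<And>x y c. weighted s x \<Longrightarrow> weighted s y \<Longrightarrow> N (\<lambda>n. x n + of_real c * y n) \<le> N x + \<bar>c\<bar> * N y"
    and bound: "\<And>x. weighted s x \<Longrightarrow> N x \<le> M * weighted_norm s x"
    and a: "\<And>t. weighted s (a t)"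
    and deriv: "\<And>t. \<exists>d r K. weighted s d \<and> (\<forall>h. N (\<lambda>n. a t n + of_real h * d n) \<le> N (a t) + K * h\<^sup>2) \<and>
        (\<forall>h. h \<noteq> 0 \<longrightarrow> weighted s (r h) \<and> a (t + h) = (\<lambda>n. a t n + of_real h * (d n + r h n))) \<and>
        ((\<lambda>h. weighted_norm s (r h)) \<longlongrightarrow> 0) (at 0)"
  shows "N (a t) = N (a 0)"
proof -
  define g where "g t = N (a t)" for t
  have expansion: "\<exists>D K \<rho>. (\<rho> \<longlongrightarrow> 0) (at 0) \<and> (\<forall>h. h \<noteq> 0 \<longrightarrow>
      g (t + h) \<le> g t + K * h\<^sup>2 + \<bar>h\<bar> * \<rho> h \<and> \<bar>g (t + h) - g t\<bar> \<le> \<bar>h\<bar> * (D + \<rho> h))" for t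
  proof -
    obtain d r K where d: "weighted s d" "\<And>h. N (\<lambda>n. a t n + of_real h * d n) \<le> N (a t) + K * h\<^sup>2"
      and r: "\<And>h. h \<noteq> 0 \<Longrightarrow> weighted s (r h)" "\<And>h. h \<noteq> 0 \<Longrightarrow> a (t + h) = (\<lambda>n. a t n + of_real h * (d n + r h n))"
      and lim: "((\<lambda>h. weighted_norm s (r h)) \<longlongrightarrow> 0) (at 0)"
      using deriv[of t] by blast
    define \<rho> where "\<rho> h = M * weighted_norm s (r h)" for h
    have "(\<rho> \<longlongrightarrow> M * 0) (at 0)" unfolding \<rho>_def by (intro tendsto_intros lim)
    moreover have "g (t + h) \<le> g t + K * h\<^sup>2 + \<bar>h\<bar> * \<rho> h \<and> \<bar>g (t + h) - g t\<bar> \<le> \<bar>h\<bar> * (N d + \<rho> h)"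
      if h: "h \<noteq> 0" for h
    proof -
      have Nr: "N (r h) \<le> \<rho> h" using bound[OF r(1)[OF h]] by (simp add: \<rho>_def)
      have dr: "weighted s (\<lambda>n. d n + of_real 1 * r h n)" "N (\<lambda>n. d n + of_real 1 * r h n) \<le> N d + \<rho> h"
        using weighted_lincomb[OF d(1) r(1)[OF h], of "of_real 1"] tri[OF d(1) r(1)[OF h], of 1] Nr by auto
      have e1: "a (t + h) = (\<lambda>n. (a t n + of_real h * d n) + of_real h * r h n)"
        using r(2)[OF h] by (simp add: algebra_simps)
      have e2: "a (t + h) = (\<lambda>n. a t n + of_real h * (d n + of_real 1 * r h n))"
        using r(2)[OF h] by simp
      \<comment> \<open>Going back from \<open>t + h\<close> to \<open>t\<close> gives the lower bound needed for continuity.\<close>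
      have e3: "a t = (\<lambda>n. a (t + h) n + of_real (- h) * (d n + of_real 1 * r h n))"
        using r(2)[OF h] by (auto simp: algebra_simps)
      have "g (t + h) \<le> N (\<lambda>n. a t n + of_real h * d n) + \<bar>h\<bar> * N (r h)"
        unfolding g_def e1 by (intro tri weighted_lincomb a d r h)
      also have "\<dots> \<le> g t + K * h\<^sup>2 + \<bar>h\<bar> * \<rho> h"
        unfolding g_def using d(2)[of h] Nr by (intro add_mono mult_left_mono) auto
      finally have 1: "g (t + h) \<le> g t + K * h\<^sup>2 + \<bar>h\<bar> * \<rho> h" .
      have m: "\<bar>h\<bar> * N (\<lambda>n. d n + of_real 1 * r h n) \<le> \<bar>h\<bar> * (N d + \<rho> h)"
        using dr(2) by (intro mult_left_mono) auto
      have 2: "g (t + h) \<le> g t + \<bar>h\<bar> * N (\<lambda>n. d n + of_real 1 * r h n)"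
        unfolding g_def e2 by (intro tri a dr)
      have "N (\<lambda>n. a (t + h) n + of_real (- h) * (d n + of_real 1 * r h n)) \<le> N (a (t + h)) + \<bar>- h\<bar> * N (\<lambda>n. d n + of_real 1 * r h n)"
        by (intro tri a dr)
      then have 3: "g t \<le> g (t + h) + \<bar>h\<bar> * N (\<lambda>n. d n + of_real 1 * r h n)"
        unfolding e3[symmetric] g_def by simp
      show ?thesis using 1 2 3 m by linarith
    qed
    ultimately show ?thesis by (intro exI[of _ "N d"] exI[of _ K] exI[of _ \<rho>]) simp
  qed
  have cont: "continuous_on UNIV g"
  proof (intro continuous_at_imp_continuous_on ballI)
    fix t
    obtain D \<rho> where \<rho>: "(\<rho> \<longlongrightarrow> 0) (at 0)" "\<And>h. h \<noteq> 0 \<Longrightarrow> \<bar>g (t + h) - g t\<bar> \<le> \<bar>h\<bar> * (D + \<rho> h)"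
      using expansion[of t] by blast
    have "((\<lambda>h. \<bar>h\<bar> * (D + \<rho> h)) \<longlongrightarrow> \<bar>0\<bar> * (D + 0)) (at 0)" by (intro tendsto_intros \<rho>)
    then have lim: "((\<lambda>h. \<bar>h\<bar> * (D + \<rho> h)) \<longlongrightarrow> 0) (at 0)" by simp
    have "\<forall>\<^sub>F h in at 0. norm (g (t + h) - g t) \<le> \<bar>h\<bar> * (D + \<rho> h)"
      unfolding real_norm_def eventually_at_filter by (rule always_eventually) (use \<rho>(2) in blast)
    then have "((\<lambda>h. g (t + h) - g t) \<longlongrightarrow> 0) (at 0)"
      using lim by (rule Lim_null_comparison)
    then show "isCont g t" by (simp add: isCont_iff Lim_null[symmetric])
  qed
  have step: "\<exists>\<delta>>0. \<forall>h. h \<noteq> 0 \<and> \<bar>h\<bar> < \<delta> \<longrightarrow> g (t + h) \<le> g t + e * \<bar>h\<bar>" if e: "e > 0" for t e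
  proof -
    obtain K \<rho> where \<rho>: "(\<rho> \<longlongrightarrow> 0) (at 0)" "\<And>h. h \<noteq> 0 \<Longrightarrow> g (t + h) \<le> g t + K * h\<^sup>2 + \<bar>h\<bar> * \<rho> h"
      using expansion[of t] by blast
    have "((\<lambda>h. K * \<bar>h\<bar> + \<rho> h) \<longlongrightarrow> K * \<bar>0\<bar> + 0) (at 0)" by (intro tendsto_intros \<rho>)
    then have "\<forall>\<^sub>F h in at 0. K * \<bar>h\<bar> + \<rho> h < e" using e by (intro order_tendstoD) auto
    then obtain \<delta> where \<delta>: "\<delta> > 0" "\<And>h. h \<noteq> 0 \<Longrightarrow> \<bar>h\<bar> < \<delta> \<Longrightarrow> K * \<bar>h\<bar> + \<rho> h < e"
      unfolding eventually_at by (auto simp: dist_real_def)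
    have "g (t + h) \<le> g t + e * \<bar>h\<bar>" if "h \<noteq> 0" "\<bar>h\<bar> < \<delta>" for h
    proof -
      have "\<bar>h\<bar> * (K * \<bar>h\<bar> + \<rho> h) \<le> \<bar>h\<bar> * e" using \<delta>(2)[OF that] by (intro mult_left_mono) auto
      moreover have "\<bar>h\<bar> * (K * \<bar>h\<bar> + \<rho> h) = K * h\<^sup>2 + \<bar>h\<bar> * \<rho> h"
        by (simp add: algebra_simps power2_eq_square)
      ultimately show ?thesis using \<rho>(2)[OF that(1)] by (simp add: mult.commute)
    qed
    then show ?thesis using \<delta>(1) by blast
  qed
  have up: "g v \<le> g u" if "u \<le> v" for u v
  proof (rule dini_nonincreasing[OF cont that])
    show "\<exists>d>0. \<forall>h. 0 < h \<and> h < d \<longrightarrow> g (t + h) \<le> g t + e * h" if "e > 0" for t e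
      using step[OF that, of t] by (metis abs_of_pos less_irrefl)
  qed
  have down: "g u \<le> g v" if "u \<le> v" for u v
  proof -
    have "g (- (- u)) \<le> g (- (- v))"
    proof (rule dini_nonincreasing[where g="\<lambda>x. g (- x)"])
      show "continuous_on UNIV (\<lambda>x. g (- x))"
        by (intro continuous_on_compose2[OF cont] continuous_intros) auto
      show "\<exists>d>0. \<forall>h. 0 < h \<and> h < d \<longrightarrow> g (- (t + h)) \<le> g (- t) + e * h" if e: "e > 0" for t e
      proof -
        obtain d where d: "d > 0" "\<And>h. h \<noteq> 0 \<Longrightarrow> \<bar>h\<bar> < d \<Longrightarrow> g (- t + h) \<le> g (- t) + e * \<bar>h\<bar>"
          using step[OF e, of "- t"] by blast
        have "g (- (t + h)) \<le> g (- t) + e * h" if "0 < h" "h < d" for h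
          using d(2)[of "- h"] that by simp
        then show ?thesis using d(1) by blast
      qed
    qed (use that in simp)
    then show ?thesis by simp
  qed
  have "g t = g 0" using up[of 0 t] down[of 0 t] up[of t 0] down[of t 0] by linarith
  then show ?thesis by (simp add: g_def)
qed

section \<open>Solutions of the equation\<close>

text \<open>
  The coefficients of nonnegative index carry all the information on \<open>L2_plus\<close>.
\<close>

definition fourier_seq :: "(complex \<Rightarrow> complex) \<Rightarrow> nat \<Rightarrow> complex" where
  "fourier_seq u n = fourier_coeff u (int n)"

text \<open>
  The sum over the natural numbers is part of the sum over the integers.
\<close>

lemma weighted_fourier_seq:
  assumes "u \<in> Hs_circle s"
  shows "weighted s (fourier_seq u)" "weighted_norm s (fourier_seq u) \<le> Hs_norm s u"
proof -
  let ?g = "\<lambda>k::int. (1 + (real_of_int k)\<^sup>2) powr s * (cmod (fourier_coeff u k))\<^sup>2"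
  have g: "?g summable_on UNIV" using assms by (simp add: Hs_circle_def)
  have gr: "?g summable_on range int" using g by (rule summable_on_subset_banach) simp
  have i: "inj int" by simp
  show "weighted s (fourier_seq u)"
    using summable_on_reindex[OF i, of ?g] gr by (simp add: weighted_def fourier_seq_def o_def)
  have "(\<Sum>\<^sub>\<infinity>n. (1 + (real n)\<^sup>2) powr s * (cmod (fourier_seq u n))\<^sup>2) = infsum ?g (range int)"
    using infsum_reindex[OF i, of ?g] by (simp add: fourier_seq_def o_def)
  also have "\<dots> \<le> infsum ?g UNIV" by (rule infsum_mono2[OF gr g]) auto
  finally show "weighted_norm s (fourier_seq u) \<le> Hs_norm s u"
    unfolding weighted_norm_def Hs_norm_def by (rule real_sqrt_le_mono)
qed

lemma Hs_circle_lincomb: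
  assumes u: "u \<in> Hs_circle s" and v: "v \<in> Hs_circle s"
  shows "(\<lambda>z. a * u z + b * v z) \<in> Hs_circle s"
proof -
  have L: "u \<in> L2_circle" "v \<in> L2_circle" using u v by (auto simp: Hs_circle_def)
  let ?w = "\<lambda>k::int. (1 + (real_of_int k)\<^sup>2) powr s"
  have "(\<lambda>k. ?w k * (cmod (fourier_coeff (\<lambda>z. a * u z + b * v z) k))\<^sup>2) summable_on UNIV"
  proof (rule summable_on_comparison_test)
    show "(\<lambda>k. 2 * (cmod a)\<^sup>2 * (?w k * (cmod (fourier_coeff u k))\<^sup>2) + 2 * (cmod b)\<^sup>2 * (?w k * (cmod (fourier_coeff v k))\<^sup>2)) summable_on UNIV"
      using u v unfolding Hs_circle_def by (intro summable_on_add summable_on_cmult_right) auto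
    fix k
    let ?x = "fourier_coeff u k" and ?y = "fourier_coeff v k"
    have "(cmod (a * ?x + b * ?y))\<^sup>2 \<le> 2 * (cmod (a * ?x))\<^sup>2 + 2 * (cmod (b * ?y))\<^sup>2"
      by (rule cmod_add_square_le)
    then have "?w k * (cmod (a * ?x + b * ?y))\<^sup>2 \<le> ?w k * (2 * (cmod (a * ?x))\<^sup>2 + 2 * (cmod (b * ?y))\<^sup>2)"
      by (intro mult_left_mono) auto
    then show "?w k * (cmod (fourier_coeff (\<lambda>z. a * u z + b * v z) k))\<^sup>2 \<le>
      2 * (cmod a)\<^sup>2 * (?w k * (cmod ?x)\<^sup>2) + 2 * (cmod b)\<^sup>2 * (?w k * (cmod ?y)\<^sup>2)"
      unfolding fourier_coeff_lincomb[OF L] by (simp add: norm_mult power_mult_distrib algebra_simps)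
  qed auto
  then show ?thesis using L2_circle_lincomb[OF L] by (simp add: Hs_circle_def)
qed

lemma cubic_iterated:
  assumes a: "a abs_summable_on UNIV"
  shows "(\<Sum>\<^sub>\<infinity>p. \<Sum>\<^sub>\<infinity>r. a p * a r * (if n \<le> p + r then cnj (a (p + r - n)) else 0)) = cubic a n"
proof -
  have "(\<lambda>(p, r). a p * a r * (if n \<le> p + r then cnj (a (p + r - n)) else 0)) summable_on UNIV \<times> UNIV"
    using abs_summable_summable[OF cubic_term_summable[OF a, of n]] by (simp add: cubic_term_def)
  from infsum_Sigma'_banach[OF this] show ?thesis by (simp add: cubic_def cubic_term_def)
qed

text \<open>
  Absolute convergence makes the power series a bounded function with the same coefficients, and
  Fourier coefficients determine the function.
\<close>

lemma Hs_plus_eq_power_series: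
  assumes s: "s > 1" and u: "u \<in> Hs_plus s"
  shows "fourier_seq u abs_summable_on UNIV" "circle_eq u (power_series (fourier_seq u))"
proof -
  have uL: "u \<in> L2_circle" and uH: "u \<in> Hs_circle s" and un: "\<And>k. k < 0 \<Longrightarrow> fourier_coeff u k = 0"
    using u by (auto simp: Hs_plus_def L2_plus_def)
  show a: "fourier_seq u abs_summable_on UNIV"
    using weighted_regular(1)[OF s weighted_fourier_seq(1)[OF uH]] by (simp add: regular_def)
  show "circle_eq u (power_series (fourier_seq u))"
  proof (rule fourier_coeff_inject[OF uL circle_bounded_L2[OF power_series_circle_bounded[OF a]]])
    show "fourier_coeff u k = fourier_coeff (power_series (fourier_seq u)) k" for k
      unfolding fourier_coeff_power_series[OF a] using un[of k] by (auto simp: fourier_seq_def)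
  qed
qed

text \<open>
  The projector is specified by a choice, so a function with the prescribed coefficients has to be exhibited
  before anything is known about the chosen one: the power series with coefficients \<open>cubic\<close> qualifies.
\<close>

lemma szego_proj_cubic:
  assumes s: "s > 1" and u: "u \<in> Hs_plus s"
  shows "szego_proj (\<lambda>w. complex_of_real ((cmod (u w))\<^sup>2) * u w) \<in> L2_circle"
    and "fourier_seq (szego_proj (\<lambda>w. complex_of_real ((cmod (u w))\<^sup>2) * u w)) = cubic (fourier_seq u)"
proof -
  let ?a = "fourier_seq u" and ?w = "\<lambda>w. complex_of_real ((cmod (u w))\<^sup>2) * u w"
  note a = Hs_plus_eq_power_series(1)[OF s u] and eq = Hs_plus_eq_power_series(2)[OF s u]
  have um: "(\<lambda>x. u (cis x)) \<in> borel_measurable circle_measure"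
    using u by (auto simp: Hs_plus_def L2_plus_def L2_circle_def)
  have pm: "(\<lambda>x. power_series ?a (cis x)) \<in> borel_measurable circle_measure"
    using power_series_circle_bounded[OF a] by (simp add: circle_bounded_def)
  have w: "fourier_coeff ?w (int n) = cubic ?a n" for n
  proof -
    have "fourier_coeff ?w (int n) = fourier_coeff (\<lambda>z. of_real ((cmod (power_series ?a z))\<^sup>2) * power_series ?a z) (int n)"
    proof (rule fourier_coeff_cong_AE)
      show "circle_eq ?w (\<lambda>z. of_real ((cmod (power_series ?a z))\<^sup>2) * power_series ?a z)"
        using eq unfolding circle_eq_def by eventually_elim simp
    qed (use um pm in measurable)
    then show ?thesis by (simp only: fourier_coeff_cubic[OF a] cubic_iterated[OF a])
  qed
  note c = cubic_abs_summable[OF a]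
  have "\<exists>v. v \<in> L2_circle \<and> (\<forall>k. fourier_coeff v k = (if k \<ge> 0 then fourier_coeff ?w k else 0))"
  proof (intro exI conjI allI)
    show "power_series (cubic ?a) \<in> L2_circle" by (rule circle_bounded_L2[OF power_series_circle_bounded[OF c]])
    show "fourier_coeff (power_series (cubic ?a)) k = (if k \<ge> 0 then fourier_coeff ?w k else 0)" for k
      unfolding fourier_coeff_power_series[OF c] using w[of "nat k"] by auto
  qed
  from someI_ex[OF this] have *: "szego_proj ?w \<in> L2_circle"
    "\<And>k. fourier_coeff (szego_proj ?w) k = (if k \<ge> 0 then fourier_coeff ?w k else 0)"
    unfolding szego_proj_def by auto
  show "szego_proj ?w \<in> L2_circle" by (rule *(1))
  show "fourier_seq (szego_proj ?w) = cubic ?a"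
    using w *(2) by (auto simp: fourier_seq_def)
qed

lemma one_L2: "(\<lambda>_. 1) \<in> L2_circle"
  by (rule circle_bounded_L2) (auto simp: circle_bounded_def)

lemma fourier_seq_one: "fourier_seq (\<lambda>_. 1) n = (if n = 0 then 1 else 0)"
  using fourier_coeff_power[of 0 "int n"] by (simp add: fourier_seq_def)

lemma fourier_seq_lincomb:
  "u \<in> L2_circle \<Longrightarrow> v \<in> L2_circle \<Longrightarrow> fourier_seq (\<lambda>z. a * u z + b * v z) n = a * fourier_seq u n + b * fourier_seq v n"
  unfolding fourier_seq_def by (rule fourier_coeff_lincomb)

lemma szego_equation_fourier:
  assumes s: "s > 1" and u: "u \<in> Hs_plus s" and v: "v \<in> L2_circle"
    and eq: "circle_eq (\<lambda>z. \<i> * v z)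
          (\<lambda>z. szego_proj (\<lambda>w. complex_of_real ((cmod (u w))\<^sup>2) * u w) z
                + complex_of_real \<alpha> * circle_inner u (\<lambda>_. 1))"
  shows "fourier_seq v n = - \<i> * (cubic (fourier_seq u) n + (if n = 0 then of_real \<alpha> * fourier_seq u 0 else 0))"
proof -
  let ?p = "szego_proj (\<lambda>w. complex_of_real ((cmod (u w))\<^sup>2) * u w)"
  let ?c = "complex_of_real \<alpha> * circle_inner u (\<lambda>_. 1)"
  note p = szego_proj_cubic[OF s u]
  have c: "circle_inner u (\<lambda>_. 1) = fourier_seq u 0"
    by (simp add: fourier_seq_def fourier_coeff_def)
  have L: "(\<lambda>z. \<i> * v z + 0 * v z) \<in> L2_circle" "(\<lambda>z. 1 * ?p z + ?c * 1) \<in> L2_circle"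
    using L2_circle_lincomb[OF v v, of \<i> 0] L2_circle_lincomb[OF p(1) one_L2, of 1 ?c] .
  have "\<i> * fourier_seq v n = fourier_seq (\<lambda>z. \<i> * v z + 0 * v z) n"
    using fourier_seq_lincomb[OF v v, of \<i> 0 n] by simp
  also have "\<dots> = fourier_seq (\<lambda>z. 1 * ?p z + ?c * 1) n"
    unfolding fourier_seq_def
    by (rule fourier_coeff_cong_AE) (use eq L in \<open>auto simp: L2_circle_def\<close>)
  also have "\<dots> = cubic (fourier_seq u) n + (if n = 0 then of_real \<alpha> * fourier_seq u 0 else 0)"
    using fourier_seq_lincomb[OF p(1) one_L2, of 1 ?c n] unfolding p(2) c fourier_seq_one by auto
  finally have "- \<i> * (\<i> * fourier_seq v n) = - \<i> * (cubic (fourier_seq u) n + (if n = 0 then of_real \<alpha> * fourier_seq u 0 else 0))"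
    by simp
  then show ?thesis by simp
qed

text \<open>
  The differentiability in \<open>H\<^sup>s\<close>, read off on coefficients: the remainder \<open>r\<close> of the difference
  quotient tends to zero in the weighted norm.
\<close>

lemma szego_solution_fourier_deriv:
  assumes s: "s > 1" and sol: "szego_solution \<alpha> s u"
  shows "\<exists>d r. weighted s d \<and>
     (\<forall>n. d n = - \<i> * (cubic (fourier_seq (u t)) n + (if n = 0 then of_real \<alpha> * fourier_seq (u t) 0 else 0))) \<and>
     (\<forall>h::real. h \<noteq> 0 \<longrightarrow> weighted s (r h) \<and> fourier_seq (u (t + h)) = (\<lambda>n. fourier_seq (u t) n + of_real h * (d n + r h n))) \<and>
     ((\<lambda>h. weighted_norm s (r h)) \<longlongrightarrow> 0) (at 0)"
proof -
  have uH: "u t \<in> Hs_plus s" for t using sol by (simp add: szego_solution_def)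
  obtain v where v: "has_Hs_derivative s u v t"
    and eq: "circle_eq (\<lambda>z. \<i> * v z)
          (\<lambda>z. szego_proj (\<lambda>w. complex_of_real ((cmod (u t w))\<^sup>2) * u t w) z
                + complex_of_real \<alpha> * circle_inner (u t) (\<lambda>_. 1))"
    using sol unfolding szego_solution_def by blast
  have vH: "v \<in> Hs_circle s"
    and lim: "((\<lambda>h. Hs_norm s (\<lambda>z. (u (t + h) z - u t z) / complex_of_real h - v z)) \<longlongrightarrow> 0) (at 0)"
    using v by (auto simp: has_Hs_derivative_def)
  have uC: "u t \<in> Hs_circle s" for t using uH by (simp add: Hs_plus_def)
  have L: "w \<in> L2_circle" if "w \<in> Hs_circle s" for w using that by (simp add: Hs_circle_def)
  define D where "D h = (\<lambda>z. (u (t + h) z - u t z) / complex_of_real h - v z)" for h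
  define q where "q h = (\<lambda>z. (1 / complex_of_real h) * u (t + h) z + (- 1 / complex_of_real h) * u t z)" for h
  have q: "q h \<in> Hs_circle s" for h unfolding q_def by (rule Hs_circle_lincomb[OF uC uC])
  have D: "D h = (\<lambda>z. 1 * q h z + (-1) * v z)" for h
    by (intro ext) (simp add: D_def q_def diff_divide_distrib)
  have DH: "D h \<in> Hs_circle s" for h unfolding D by (rule Hs_circle_lincomb[OF q vH])
  have Dc: "fourier_seq (D h) n = (fourier_seq (u (t + h)) n - fourier_seq (u t) n) / of_real h - fourier_seq v n" for h n
  proof -
    have "fourier_seq (D h) n = 1 * fourier_seq (q h) n + (-1) * fourier_seq v n"
      unfolding D by (rule fourier_seq_lincomb[OF L[OF q] L[OF vH]])
    moreover have "fourier_seq (q h) n = (1 / of_real h) * fourier_seq (u (t + h)) n + (- 1 / of_real h) * fourier_seq (u t) n"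
      unfolding q_def by (rule fourier_seq_lincomb[OF L[OF uC] L[OF uC]])
    ultimately show ?thesis by (simp add: diff_divide_distrib)
  qed
  have "((\<lambda>h. weighted_norm s (fourier_seq (D h))) \<longlongrightarrow> 0) (at 0)"
  proof (rule tendsto_sandwich[OF _ _ tendsto_const])
    show "((\<lambda>h. Hs_norm s (D h)) \<longlongrightarrow> 0) (at 0)" using lim by (simp add: D_def)
    show "\<forall>\<^sub>F h in at 0. 0 \<le> weighted_norm s (fourier_seq (D h))" by (simp add: weighted_norm_nonneg)
    show "\<forall>\<^sub>F h in at 0. weighted_norm s (fourier_seq (D h)) \<le> Hs_norm s (D h)"
      using weighted_fourier_seq(2)[OF DH] by simp
  qed
  moreover have "fourier_seq (u (t + h)) = (\<lambda>n. fourier_seq (u t) n + of_real h * (fourier_seq v n + fourier_seq (D h) n))"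
    if "h \<noteq> 0" for h
    using that by (intro ext) (simp add: Dc)
  ultimately show ?thesis
    using weighted_fourier_seq(1)[OF vH] weighted_fourier_seq(1)[OF DH] szego_equation_fourier[OF s uH L[OF vH] eq]
    by (intro exI[of _ "fourier_seq v"] exI[of _ "\<lambda>h. fourier_seq (D h)"]) blast
qed

text \<open>
  The coefficients entering the Hankel matrix have positive index, where the derivative \<open>d\<close> has no contribution from \<open>\<alpha>\<close>.
\<close>

lemma trace_norm_conserved:
  assumes s: "s > 1" and sol: "szego_solution \<alpha> s u"
  shows "trace_norm (fourier_seq (u t)) = trace_norm (fourier_seq (u 0))"
proof (rule seminorm_conserved[where s = s and N = trace_norm and M = "row_decay_sum s" and a = "\<lambda>t. fourier_seq (u t)"])
  have a: "weighted s (fourier_seq (u t))" for t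
    using sol by (intro weighted_fourier_seq) (simp add: szego_solution_def Hs_plus_def)
  then show "weighted s (fourier_seq (u t))" for t .
  show "trace_norm (\<lambda>n. x n + of_real c * y n) \<le> trace_norm x + \<bar>c\<bar> * trace_norm y" if "weighted s x" "weighted s y" for x y c
    using trace_norm_triangle[OF weighted_regular(1)[OF s that(1)] weighted_regular(1)[OF s that(2)], of "of_real c"] by simp
  show "trace_norm x \<le> row_decay_sum s * weighted_norm s x" if "weighted s x" for x
    using trace_norm_le_row_norm_sum[OF weighted_regular(1)[OF s that]] weighted_regular(2)[OF s that] by linarith
  fix t
  obtain d r where d: "weighted s d"
      "\<And>n. d n = - \<i> * (cubic (fourier_seq (u t)) n + (if n = 0 then of_real \<alpha> * fourier_seq (u t) 0 else 0))"
    and r: "\<forall>h::real. h \<noteq> 0 \<longrightarrow> weighted s (r h) \<and> fourier_seq (u (t + h)) = (\<lambda>n. fourier_seq (u t) n + of_real h * (d n + r h n))"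
      "((\<lambda>h. weighted_norm s (r h)) \<longlongrightarrow> 0) (at 0)"
    using szego_solution_fourier_deriv[OF s sol, of t] by blast
  have reg: "regular (fourier_seq (u t))" by (rule weighted_regular(1)[OF s a])
  have d1: "d abs_summable_on UNIV" using weighted_regular(1)[OF s d(1)] by (simp add: regular_def)
  obtain \<kappa> C where C: "schur \<kappa> C" "\<And>j k. C k j = - cnj (C j k)"
    "\<And>j k. - \<i> * cubic (fourier_seq (u t)) (j + k + 1) = mat_mult C (hankel (fourier_seq (u t))) j k + mat_mult C (hankel (fourier_seq (u t))) k j"
    using lax_pair[of "fourier_seq (u t)"] reg unfolding regular_def by blast
  have lax: "d (j + k + 1) = mat_mult C (hankel (fourier_seq (u t))) j k + mat_mult C (hankel (fourier_seq (u t))) k j" for j k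
    using C(3)[of j k] d(2)[of "j + k + 1"] by simp
  have "trace_norm (\<lambda>n. fourier_seq (u t) n + of_real h * d n) \<le> trace_norm (fourier_seq (u t)) + (2 * \<kappa>\<^sup>2 + 1) * trace_norm (fourier_seq (u t)) * h\<^sup>2" for h
    by (rule trace_norm_lax_step[OF reg d1 C(1,2) lax])
  then show "\<exists>d r K. weighted s d \<and> (\<forall>h. trace_norm (\<lambda>n. fourier_seq (u t) n + of_real h * d n) \<le> trace_norm (fourier_seq (u t)) + K * h\<^sup>2) \<and>
      (\<forall>h. h \<noteq> 0 \<longrightarrow> weighted s (r h) \<and> fourier_seq (u (t + h)) = (\<lambda>n. fourier_seq (u t) n + of_real h * (d n + r h n))) \<and>
      ((\<lambda>h. weighted_norm s (r h)) \<longlongrightarrow> 0) (at 0)"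
    using d(1) r by blast
qed

lemma l2_norm_conserved:
  assumes s: "s > 1" and sol: "szego_solution \<alpha> s u"
  shows "l2_norm (fourier_seq (u t)) = l2_norm (fourier_seq (u 0))"
proof (rule seminorm_conserved[where s = s and N = l2_norm and M = 1 and a = "\<lambda>t. fourier_seq (u t)"])
  have s0: "s \<ge> 0" using s by simp
  have a: "weighted s (fourier_seq (u t))" for t
    using sol by (intro weighted_fourier_seq) (simp add: szego_solution_def Hs_plus_def)
  then show "weighted s (fourier_seq (u t))" for t .
  show "l2_norm (\<lambda>n. x n + of_real c * y n) \<le> l2_norm x + \<bar>c\<bar> * l2_norm y" if "weighted s x" "weighted s y" for x y c
    using ell2_add(2)[OF weighted_ell2(1)[OF s0 that(1)] ell2_cmult[OF weighted_ell2(1)[OF s0 that(2)]], of "of_real c"]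
    by (simp add: l2_norm_cmult)
  show "l2_norm x \<le> 1 * weighted_norm s x" if "weighted s x" for x using weighted_ell2(2)[OF s0 that] by simp
  fix t
  let ?a = "fourier_seq (u t)"
  obtain d r where d: "weighted s d"
      "\<And>n. d n = - \<i> * (cubic ?a n + (if n = 0 then of_real \<alpha> * ?a 0 else 0))"
    and r: "\<forall>h::real. h \<noteq> 0 \<longrightarrow> weighted s (r h) \<and> fourier_seq (u (t + h)) = (\<lambda>n. ?a n + of_real h * (d n + r h n))"
      "((\<lambda>h. weighted_norm s (r h)) \<longlongrightarrow> 0) (at 0)"
    using szego_solution_fourier_deriv[OF s sol, of t] by blast
  have reg: "?a abs_summable_on UNIV" using weighted_regular(1)[OF s a] by (simp add: regular_def)
  obtain \<kappa> C where C: "schur \<kappa> C" "\<And>j k. C k j = - cnj (C j k)"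
    "\<And>j. - \<i> * (cubic ?a j + (if j = 0 then of_real \<alpha> * ?a 0 else 0)) = mat_apply C ?a j"
    using mass_skew[OF reg] by blast
  have step: "l2_norm (\<lambda>n. ?a n + of_real h * d n) \<le> l2_norm ?a + (\<kappa>\<^sup>2 * l2_norm ?a) * h\<^sup>2" for h
  proof -
    let ?x = "h\<^sup>2 * \<kappa>\<^sup>2"
    have "(l2_norm (\<lambda>n. ?a n + of_real h * d n))\<^sup>2 \<le> (1 + ?x) * (l2_norm ?a)\<^sup>2"
      using l2_norm_skew_step[OF C(1,2) weighted_ell2(1)[OF s0 a[of t]], of h] by (simp only: d(2) C(3))
    also have "\<dots> \<le> (1 + ?x)\<^sup>2 * (l2_norm ?a)\<^sup>2"
      by (intro mult_right_mono) (auto simp: power2_sum)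
    finally have "(l2_norm (\<lambda>n. ?a n + of_real h * d n))\<^sup>2 \<le> ((1 + ?x) * l2_norm ?a)\<^sup>2"
      by (simp add: power_mult_distrib)
    then have "l2_norm (\<lambda>n. ?a n + of_real h * d n) \<le> (1 + ?x) * l2_norm ?a"
      by (rule power2_le_imp_le) auto
    then show ?thesis by (simp add: algebra_simps)
  qed
  then show "\<exists>d r K. weighted s d \<and> (\<forall>h. l2_norm (\<lambda>n. ?a n + of_real h * d n) \<le> l2_norm ?a + K * h\<^sup>2) \<and>
      (\<forall>h. h \<noteq> 0 \<longrightarrow> weighted s (r h) \<and> fourier_seq (u (t + h)) = (\<lambda>n. ?a n + of_real h * (d n + r h n))) \<and>
      ((\<lambda>h. weighted_norm s (r h)) \<longlongrightarrow> 0) (at 0)"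
    using d(1) r by blast
qed

lemma wiener_norm_le_trace_norm:
  assumes "regular (fourier_seq u)"
  shows "wiener_norm u \<le> ennreal (cmod (fourier_seq u 0) + 2 * trace_norm (fourier_seq u))"
proof -
  have "(\<Sum>k<N. ennreal (cmod (fourier_seq u k))) \<le> ennreal (cmod (fourier_seq u 0) + 2 * trace_norm (fourier_seq u))" for N
    using partial_wiener_le_trace_norm[OF assms, of N] by (simp add: sum_ennreal ennreal_leI)
  then have "(\<Sum>k. ennreal (cmod (fourier_seq u k))) \<le> ennreal (cmod (fourier_seq u 0) + 2 * trace_norm (fourier_seq u))"
    by (intro suminf_le_const) auto
  then show ?thesis by (simp add: wiener_norm_def fourier_seq_def)
qed

theorem proposition3p1:
  fixes s :: real
  assumes "s > 1"
  shows "\<exists>C>0. \<forall>(\<alpha>::real) (u0 :: complex \<Rightarrow> complex) (u :: real \<Rightarrow> complex \<Rightarrow> complex).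
           u0 \<in> Hs_plus s \<longrightarrow> szego_solution \<alpha> s u \<longrightarrow> circle_eq (u 0) u0 \<longrightarrow>
           (\<forall>t. wiener_norm (u t) \<le> ennreal (C * Hs_norm s u0))"
\<comment> \<open>One for the coefficient \<open>0\<close>, and one trace norm each for the odd and the positive even indices.\<close>
proof (intro exI[of _ "1 + 2 * row_decay_sum s"] conjI allI impI)
  show "0 < 1 + 2 * row_decay_sum s" using row_decay_sum_nonneg[of s] by simp
next
  fix \<alpha> u0 u t
  assume u0: "u0 \<in> Hs_plus s" and sol: "szego_solution \<alpha> s u" and init: "circle_eq (u 0) u0"
  have uH: "u t \<in> Hs_circle s" for t using sol by (simp add: szego_solution_def Hs_plus_def)
  have u0H: "u0 \<in> Hs_circle s" using u0 by (simp add: Hs_plus_def)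
  have c0: "fourier_seq (u 0) = fourier_seq u0"
    unfolding fourier_seq_def using uH[of 0] u0H
    by (intro ext fourier_coeff_cong_AE[OF init]) (auto simp: Hs_circle_def L2_circle_def)
  have hs0: "weighted s (fourier_seq u0)" and n0: "weighted_norm s (fourier_seq u0) \<le> Hs_norm s u0"
    using weighted_fourier_seq[OF u0H] .
  have reg: "regular (fourier_seq (u t))" for t
    by (rule weighted_regular(1)[OF assms weighted_fourier_seq(1)[OF uH]])
  have "cmod (fourier_seq (u t) 0) \<le> l2_norm (fourier_seq (u t))"
    using weighted_ell2(1)[OF _ weighted_fourier_seq(1)[OF uH]] assms by (intro norm_le_l2_norm) simp
  also have "\<dots> = l2_norm (fourier_seq u0)"
    using l2_norm_conserved[OF assms sol, of t] by (simp add: c0)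
  also have "\<dots> \<le> weighted_norm s (fourier_seq u0)" using weighted_ell2(2)[OF _ hs0] assms by simp
  finally have 1: "cmod (fourier_seq (u t) 0) \<le> weighted_norm s (fourier_seq u0)" .
  have "trace_norm (fourier_seq (u t)) = trace_norm (fourier_seq u0)"
    using trace_norm_conserved[OF assms sol, of t] by (simp add: c0)
  also have "\<dots> \<le> row_decay_sum s * weighted_norm s (fourier_seq u0)"
    using trace_norm_le_row_norm_sum[OF weighted_regular(1)[OF assms hs0]] weighted_regular(2)[OF assms hs0] by linarith
  finally have "cmod (fourier_seq (u t) 0) + 2 * trace_norm (fourier_seq (u t)) \<le> (1 + 2 * row_decay_sum s) * weighted_norm s (fourier_seq u0)"
    using 1 by (simp add: algebra_simps)
  also have "\<dots> \<le> (1 + 2 * row_decay_sum s) * Hs_norm s u0"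
    using n0 row_decay_sum_nonneg[of s] by (intro mult_left_mono) auto
  finally show "wiener_norm (u t) \<le> ennreal ((1 + 2 * row_decay_sum s) * Hs_norm s u0)"
    using wiener_norm_le_trace_norm[OF reg] ennreal_leI order_trans by blast
qed

end
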